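(* Let $A$ be a self-adjoint operator in $\mathcal H$ (not necessarily semi-bounded) with form $\mathfrak a$ and $\mathcal D=\mathrm{dom}(\mathfrak a)$. Let $\gamma\in\rho(A)\cap\mathbb R$ and $\lambda_e:=\inf(\sigma_{ess}(A)\cap(\gamma,\infty))$ (with $\inf\varnothing=+\infty$). Let $(\lambda_j)_{j=1}^N$, $N\in\mathbb N_0\cup\{\infty\}$, be the eigenvalues of $A$ in $(\gamma,\lambda_e)$ in non-decreasing order, counted with multiplicities. Then $$\lambda_n=\sup_{\mathcal M\in\mathbb M^+_\gamma}\ \sup_{\substack{\mathcal L\subset\mathcal M\\ \dim\mathcal L=n-1}}\ \inf_{\substack{x\in\mathcal M\setminus\{0\}\\ x\perp\mathcal L}}\frac{\mathfrak a[x]}{\|x\|^2},\qquad n\in\mathbb N,\ n\le N.$$ Moreover, if $N$ is finite and $\sigma_{ess}(A)\cap(\gamma,\infty)\ne\varnothing$, then for every $n>N$ the same triple variation equals $\min(\sigma_{ess}(A)\cap(\gamma,\infty))$.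
   Context: "Subspace" means linear manifold, not necessarily closed. For a self-adjoint operator $A$ with spectral measure $E$, its form is $\mathfrak a[x,y]=\int_{\mathbb R}\mu\,d\langle E(\mu)x,y\rangle$ on $\mathrm{dom}(\mathfrak a)=\mathrm{dom}(|A|^{1/2})$, $\mathfrak a[x]:=\mathfrak a[x,x]$. Here $\mathbb M^+_\gamma$ denotes the set of maximal $(\mathfrak a-\gamma)$-non-negative subspaces of $\mathcal D$, i.e. subspaces $\mathcal M\subset\mathcal D$ with $\mathfrak a[x]-\gamma\|x\|^2\ge0$ for all $x\in\mathcal M$ that are not properly contained in another subspace of $\mathcal D$ with this property. *)

theory Defs
  imports "HOL-Analysis.Analysis" "HOL-Probability.Probability"
begin

text \<open>A complex Hilbert space is modelled as a real Banach space type 'h together with a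
  complex scalar multiplication sc (extending the real one) and a complex inner product ip,
  linear in the first and conjugate-linear in the second argument, inducing the norm.\<close>

definition complex_hilbert :: "(complex \<Rightarrow> 'h::banach \<Rightarrow> 'h) \<Rightarrow> ('h \<Rightarrow> 'h \<Rightarrow> complex) \<Rightarrow> bool" where
  "complex_hilbert sc ip \<longleftrightarrow> module sc
     \<and> (\<forall>r x. sc (complex_of_real r) x = r *\<^sub>R x)
     \<and> (\<forall>x y z. ip (x + y) z = ip x z + ip y z)
     \<and> (\<forall>c x y. ip (sc c x) y = c * ip x y)
     \<and> (\<forall>x y. ip y x = cnj (ip x y))
     \<and> (\<forall>x. ip x x = complex_of_real ((norm x)\<^sup>2))"

definition csubspace :: "(complex \<Rightarrow> 'h::ab_group_add \<Rightarrow> 'h) \<Rightarrow> 'h set \<Rightarrow> bool" where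
  "csubspace sc S \<longleftrightarrow> module.subspace sc S"

definition has_cdim :: "(complex \<Rightarrow> 'h::ab_group_add \<Rightarrow> 'h) \<Rightarrow> 'h set \<Rightarrow> nat \<Rightarrow> bool" where
  "has_cdim sc S k \<longleftrightarrow> (\<exists>B. finite B \<and> card B = k \<and> \<not> module.dependent sc B \<and> module.span sc B = S)"

definition finite_cdim :: "(complex \<Rightarrow> 'h::ab_group_add \<Rightarrow> 'h) \<Rightarrow> 'h set \<Rightarrow> bool" where
  "finite_cdim sc S \<longleftrightarrow> (\<exists>B. finite B \<and> S \<subseteq> module.span sc B)"

definition selfadjoint :: "(complex \<Rightarrow> 'h::banach \<Rightarrow> 'h) \<Rightarrow> ('h \<Rightarrow> 'h \<Rightarrow> complex) \<Rightarrow> ('h \<Rightarrow> 'h) \<Rightarrow> 'h set \<Rightarrow> bool" where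
  "selfadjoint sc ip A DA \<longleftrightarrow> csubspace sc DA \<and> closure DA = UNIV
     \<and> (\<forall>x\<in>DA. \<forall>y\<in>DA. A (x + y) = A x + A y)
     \<and> (\<forall>c. \<forall>x\<in>DA. A (sc c x) = sc c (A x))
     \<and> {y. \<exists>z. \<forall>x\<in>DA. ip (A x) y = ip x z} = DA
     \<and> (\<forall>x\<in>DA. \<forall>y\<in>DA. ip (A x) y = ip x (A y))"

definition resolvent_set :: "(complex \<Rightarrow> 'h::banach \<Rightarrow> 'h) \<Rightarrow> ('h \<Rightarrow> 'h) \<Rightarrow> 'h set \<Rightarrow> complex set" where
  "resolvent_set sc A DA = {z. bij_betw (\<lambda>x. A x - sc z x) DA UNIV
       \<and> (\<exists>C. \<forall>x\<in>DA. norm x \<le> C * norm (A x - sc z x))}"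

definition op_spectrum :: "(complex \<Rightarrow> 'h::banach \<Rightarrow> 'h) \<Rightarrow> ('h \<Rightarrow> 'h) \<Rightarrow> 'h set \<Rightarrow> complex set" where
  "op_spectrum sc A DA = - resolvent_set sc A DA"

definition eigenspace :: "(complex \<Rightarrow> 'h::banach \<Rightarrow> 'h) \<Rightarrow> ('h \<Rightarrow> 'h) \<Rightarrow> 'h set \<Rightarrow> complex \<Rightarrow> 'h set" where
  "eigenspace sc A DA z = {x\<in>DA. A x = sc z x}"

definition disc_spectrum :: "(complex \<Rightarrow> 'h::banach \<Rightarrow> 'h) \<Rightarrow> ('h \<Rightarrow> 'h) \<Rightarrow> 'h set \<Rightarrow> complex set" where
  "disc_spectrum sc A DA = {z\<in>op_spectrum sc A DA.
      (\<exists>e>0. ball z e \<inter> op_spectrum sc A DA = {z})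
      \<and> eigenspace sc A DA z \<noteq> {0} \<and> finite_cdim sc (eigenspace sc A DA z)}"

definition ess_spectrum :: "(complex \<Rightarrow> 'h::banach \<Rightarrow> 'h) \<Rightarrow> ('h \<Rightarrow> 'h) \<Rightarrow> 'h set \<Rightarrow> complex set" where
  "ess_spectrum sc A DA = op_spectrum sc A DA - disc_spectrum sc A DA"

definition spec_mu :: "('h \<Rightarrow> 'h \<Rightarrow> complex) \<Rightarrow> (real set \<Rightarrow> 'h \<Rightarrow> 'h) \<Rightarrow> 'h \<Rightarrow> real measure" where
  "spec_mu ip E x = measure_of UNIV (sets (borel :: real measure)) (\<lambda>S. ennreal (Re (ip (E S x) x)))"

definition spectral_measure_of :: "(complex \<Rightarrow> 'h::banach \<Rightarrow> 'h) \<Rightarrow> ('h \<Rightarrow> 'h \<Rightarrow> complex)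
     \<Rightarrow> ('h \<Rightarrow> 'h) \<Rightarrow> 'h set \<Rightarrow> (real set \<Rightarrow> 'h \<Rightarrow> 'h) \<Rightarrow> bool" where
  "spectral_measure_of sc ip A DA E \<longleftrightarrow>
     (\<forall>S\<in>sets (borel :: real measure).
         (\<forall>x y. E S (x + y) = E S x + E S y) \<and> (\<forall>c x. E S (sc c x) = sc c (E S x))
       \<and> (\<forall>x. E S (E S x) = E S x) \<and> (\<forall>x y. ip (E S x) y = ip x (E S y)))
   \<and> (\<forall>x. E UNIV x = x) \<and> (\<forall>x. E {} x = 0)
   \<and> (\<forall>S\<in>sets (borel :: real measure). \<forall>T\<in>sets (borel :: real measure). \<forall>x. E (S \<inter> T) x = E S (E T x))
   \<and> (\<forall>x. countably_additive (sets (borel :: real measure)) (\<lambda>S. ennreal (Re (ip (E S x) x))))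
   \<and> DA = {x. integrable (spec_mu ip E x) (\<lambda>t. t\<^sup>2)}
   \<and> (\<forall>x\<in>DA. ip (A x) x = complex_of_real (\<integral>t. t \<partial>(spec_mu ip E x)))"

text \<open>The form a[x] = \<integral> \<mu> d\<langle>E(\<mu>)x,x\<rangle> on dom(a) = dom(|A|^(1/2)).\<close>

definition form_dom :: "('h \<Rightarrow> 'h \<Rightarrow> complex) \<Rightarrow> (real set \<Rightarrow> 'h \<Rightarrow> 'h) \<Rightarrow> 'h set" where
  "form_dom ip E = {x. integrable (spec_mu ip E x) (\<lambda>t. t)}"

definition form_q :: "('h \<Rightarrow> 'h \<Rightarrow> complex) \<Rightarrow> (real set \<Rightarrow> 'h \<Rightarrow> 'h) \<Rightarrow> 'h \<Rightarrow> real" where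
  "form_q ip E x = (\<integral>t. t \<partial>(spec_mu ip E x))"

definition nonneg_subspace :: "(complex \<Rightarrow> 'h::banach \<Rightarrow> 'h) \<Rightarrow> ('h \<Rightarrow> 'h \<Rightarrow> complex)
     \<Rightarrow> (real set \<Rightarrow> 'h \<Rightarrow> 'h) \<Rightarrow> real \<Rightarrow> 'h set \<Rightarrow> bool" where
  "nonneg_subspace sc ip E \<gamma> M \<longleftrightarrow> csubspace sc M \<and> M \<subseteq> form_dom ip E
     \<and> (\<forall>x\<in>M. form_q ip E x - \<gamma> * (norm x)\<^sup>2 \<ge> 0)"

definition Mplus :: "(complex \<Rightarrow> 'h::banach \<Rightarrow> 'h) \<Rightarrow> ('h \<Rightarrow> 'h \<Rightarrow> complex)
     \<Rightarrow> (real set \<Rightarrow> 'h \<Rightarrow> 'h) \<Rightarrow> real \<Rightarrow> 'h set set" where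
  "Mplus sc ip E \<gamma> = {M. nonneg_subspace sc ip E \<gamma> M
      \<and> (\<forall>M'. nonneg_subspace sc ip E \<gamma> M' \<and> M \<subseteq> M' \<longrightarrow> M' = M)}"

definition triple_var :: "(complex \<Rightarrow> 'h::banach \<Rightarrow> 'h) \<Rightarrow> ('h \<Rightarrow> 'h \<Rightarrow> complex)
     \<Rightarrow> (real set \<Rightarrow> 'h \<Rightarrow> 'h) \<Rightarrow> real \<Rightarrow> nat \<Rightarrow> ereal" where
  "triple_var sc ip E \<gamma> n =
     (SUP M\<in>Mplus sc ip E \<gamma>.
        SUP L\<in>{L. L \<subseteq> M \<and> has_cdim sc L (n - 1)}.
          INF x\<in>{x\<in>M. x \<noteq> 0 \<and> (\<forall>y\<in>L. ip x y = 0)}.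
            ereal (form_q ip E x / (norm x)\<^sup>2))"

end

theory Submission
  imports Defs
begin

text \<open>Let \<open>\<D>\<^sub>+\<close> be the part of the form domain in the range of \<open>E((\<gamma>,\<infinity>))\<close>; it is itself maximal
  non-negative. If \<open>E((\<gamma>,t))\<close> has rank less than \<open>n\<close>, choosing \<open>\<M> = \<D>\<^sub>+\<close> and \<open>\<L>\<close> containing that
  range shows that the triple variation is at least \<open>t\<close>. Conversely, every maximal non-negative \<open>\<M>\<close>
  projects onto \<open>\<D>\<^sub>+\<close>, so if \<open>E((\<gamma>,t))\<close> has rank at least \<open>n\<close> its range lifts to an \<open>n\<close>-dimensional
  subspace of \<open>\<M>\<close>, which meets the orthogonal complement of \<open>\<L>\<close>; a vector \<open>x\<close> there lies in the
  range of \<open>E((-\<infinity>,t))\<close>, so its Rayleigh quotient is at most \<open>t\<close>. It remains to read off the rank of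
  \<open>E((\<gamma>,t))\<close> from the eigenvalues and the essential spectrum.\<close>

section \<open>Non-negative quadratic forms and Hilbert spaces\<close>

text \<open>The operator and the spectral measure are tied together only on the diagonal, by the
  domain and by \<open>ip (A x) x\<close>, and each measure \<open>spec_mu ip E x\<close> belongs to
  a single vector. There is no functional calculus and no sesquilinear form to compute with, so
  everything runs on diagonal values: \<open>quad\<close> encodes a quadratic form as a linear
  relation between its values at four vectors. Such a relation holds for
  \<open>(norm (E S x))\<^sup>2\<close> with every fixed \<open>S\<close>, and it survives
  integration over the spectrum. The laborious point is that a maximal \<open>M\<close> projects
  onto all of the positive part: the shifted form is indefinite, so completeness of \<open>M\<close>
  is not evident. As \<gamma> lies in the resolvent set, \<open>E\<close> vanishes on an interval
  around \<gamma>, and the integral of |t - \<gamma>| dominates a multiple of the squared norm. On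
  \<open>M\<close> the negative part of the form is at most the positive part, which therefore
  controls the norm. Together with maximality this makes \<open>M\<close> complete for the positive
  part, so best approximations in \<open>M\<close> exist.\<close>

locale nonneg_quadratic =
  fixes V :: "'a::real_vector set" and q :: "'a \<Rightarrow> real"
  assumes V: "subspace V"
    and nonneg: "x \<in> V \<Longrightarrow> 0 \<le> q x"
    and quad: "\<lbrakk>x \<in> V; y \<in> V\<rbrakk> \<Longrightarrow> q (x + s *\<^sub>R y) = (1 - s) * q x + (s\<^sup>2 - s) * q y + s * q (x + y)"
begin

lemma mem_add [simp]: "x \<in> V \<Longrightarrow> y \<in> V \<Longrightarrow> x + y \<in> V"
  and mem_diff [simp]: "x \<in> V \<Longrightarrow> y \<in> V \<Longrightarrow> x - y \<in> V"
  and mem_scale [simp]: "x \<in> V \<Longrightarrow> c *\<^sub>R x \<in> V"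
  and mem_zero [simp]: "0 \<in> V"
  using V by (auto simp: subspace_add subspace_diff subspace_scale subspace_0)

lemma q_zero [simp]: "q 0 = 0"
  using quad[of 0 0 2] by simp

lemma q_scale: "x \<in> V \<Longrightarrow> q (c *\<^sub>R x) = c\<^sup>2 * q x"
  using quad[of 0 x c] by (simp add: algebra_simps)

lemma q_minus: "x \<in> V \<Longrightarrow> q (- x) = q x"
  using q_scale[of x "-1"] by simp

lemma q_minus_commute: "x \<in> V \<Longrightarrow> y \<in> V \<Longrightarrow> q (x - y) = q (y - x)"
  using q_minus[of "x - y"] by simp

lemma parallelogram: "x \<in> V \<Longrightarrow> y \<in> V \<Longrightarrow> q (x + y) + q (x - y) = 2 * q x + 2 * q y"
  using quad[of x y "-1"] by simp

text \<open>Here \<open>r\<close> is the value at \<open>x\<close> and \<open>y\<close> of the real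
  bilinear form behind \<open>q\<close>, recovered by polarisation. Later arguments only look at the
  resulting polynomial in \<open>s\<close>.\<close>

lemma quadratic_expansion:
  assumes "x \<in> V" "y \<in> V"
  obtains r where "\<And>s. q (x + s *\<^sub>R y) = q x + 2 * s * r + s\<^sup>2 * q y"
proof
  fix s
  show "q (x + s *\<^sub>R y) = q x + 2 * s * ((q (x + y) - q x - q y) / 2) + s\<^sup>2 * q y"
    unfolding quad[OF assms] by (simp add: field_simps)
qed

text \<open>Cauchy-Schwarz comes from evaluating the non-negative polynomial in \<open>s\<close> at
  its minimiser \<open>- r / q y\<close>. Since \<open>q\<close> may vanish at nonzero vectors, the
  affine case \<open>q y = 0\<close> is separate.\<close>

lemma sqrt_triangle:
  assumes x: "x \<in> V" and y: "y \<in> V"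
  shows "sqrt (q (x + y)) \<le> sqrt (q x) + sqrt (q y)"
proof -
  obtain r where r: "\<And>s. q (x + s *\<^sub>R y) = q x + 2 * s * r + s\<^sup>2 * q y"
    using quadratic_expansion[OF x y] by blast
  have pos: "0 \<le> q x + 2 * s * r + s\<^sup>2 * q y" for s
    using nonneg[of "x + s *\<^sub>R y"] x y r by simp
  have "r\<^sup>2 \<le> q x * q y"
  proof (cases "q y = 0")
    case True
    have "r = 0"
    proof (rule ccontr)
      assume "r \<noteq> 0"
      \<comment> \<open>At this argument the affine function takes the value -1.\<close>
      with pos[of "- (q x + 1) / (2 * r)"] True show False by (simp add: field_simps)
    qed
    with True show ?thesis by simp
  next
    case False
    then have qy: "q y > 0" using nonneg[OF y] by simp
    have "0 \<le> q x - r\<^sup>2 / q y"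
      using pos[of "- r / q y"] qy by (simp add: power2_eq_square field_simps)
    with qy show ?thesis by (simp add: field_simps)
  qed
  then have "r \<le> sqrt (q x) * sqrt (q y)"
    by (metis real_le_rsqrt real_sqrt_mult)
  moreover have "q (x + y) = q x + 2 * r + q y" using r[of 1] by simp
  ultimately have "q (x + y) \<le> (sqrt (q x) + sqrt (q y))\<^sup>2"
    using nonneg[OF x] nonneg[OF y] by (simp add: power2_sum algebra_simps)
  then show ?thesis
    by (simp add: nonneg x y real_le_lsqrt)
qed

lemma sqrt_diff:
  assumes "x \<in> V" "y \<in> V"
  shows "\<bar>sqrt (q x) - sqrt (q y)\<bar> \<le> sqrt (q (x - y))"
  using sqrt_triangle[of "x - y" y] sqrt_triangle[of "y - x" x] q_minus_commute[of x y] assms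
  by simp

text \<open>The classical argument: the parallelogram law makes a minimising sequence Cauchy.
  Completeness is a hypothesis because it is applied both to a closed subspace with the norm and to
  a maximal non-negative subspace with \<open>qp\<close>. Orthogonality is expressed by Pythagoras,
  since only \<open>q\<close> itself is at hand.\<close>

lemma orthogonal_projection:
  assumes M: "subspace M" "M \<subseteq> V" and w: "w \<in> V"
    and complete: "\<And>u. \<lbrakk>\<And>k. u k \<in> M; \<And>e. e > 0 \<Longrightarrow> \<exists>K. \<forall>k\<ge>K. \<forall>l\<ge>K. q (u k - u l) < e\<rbrakk>
        \<Longrightarrow> \<exists>m\<in>M. (\<lambda>k. q (u k - m)) \<longlonglongrightarrow> 0"
  obtains m where "m \<in> M" "\<And>m'. m' \<in> M \<Longrightarrow> q (w - m + m') = q (w - m) + q m'"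
proof -
  have MV: "m \<in> V" if "m \<in> M" for m using M that by auto
  define d where "d = (INF m\<in>M. q (w - m))"
  have M0: "M \<noteq> {}" using M subspace_0 by auto
  have bdd: "bdd_below ((\<lambda>m. q (w - m)) ` M)"
    using nonneg w MV by (intro bdd_belowI2[where m=0]) auto
  have dle: "d \<le> q (w - m)" if "m \<in> M" for m
    unfolding d_def using bdd that by (rule cINF_lower)
  have "\<exists>m\<in>M. q (w - m) < d + inverse (real (Suc k))" for k
    using cInf_lessD[of "(\<lambda>m. q (w - m)) ` M" "d + inverse (real (Suc k))"] M0
    by (simp add: d_def)
  then obtain u where u: "\<And>k. u k \<in> M" "\<And>k. q (w - u k) < d + inverse (real (Suc k))"
    by metis
  have uV: "u k \<in> V" for k using u MV by auto
  have cau: "q (u k - u l) < 2 * inverse (real (Suc k)) + 2 * inverse (real (Suc l))" for k l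
  proof -
    have "q ((w - u l) + (w - u k)) = 4 * q (w - (1/2) *\<^sub>R (u l + u k))"
      using q_scale[of "w - (1/2) *\<^sub>R (u l + u k)" 2] w uV
      by (simp add: scaleR_right_diff_distrib scaleR_2 algebra_simps)
    moreover have "d \<le> q (w - (1/2) *\<^sub>R (u l + u k))"
      using M u by (intro dle subspace_scale subspace_add)
    moreover have "q ((w - u l) + (w - u k)) + q (u k - u l) = 2 * q (w - u l) + 2 * q (w - u k)"
      using parallelogram[of "w - u l" "w - u k"] w uV by simp
    ultimately show ?thesis using u(2)[of k] u(2)[of l] by linarith
  qed
  have "\<exists>m\<in>M. (\<lambda>k. q (u k - m)) \<longlonglongrightarrow> 0"
  proof (rule complete[OF u(1)])
    fix e :: real assume "e > 0"
    then obtain K where K: "inverse (real (Suc K)) < e / 4"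
      using reals_Archimedean[of "e / 4"] by auto
    have "q (u k - u l) < e" if "k \<ge> K" "l \<ge> K" for k l
    proof -
      have "inverse (real (Suc k)) \<le> inverse (real (Suc K))"
        "inverse (real (Suc l)) \<le> inverse (real (Suc K))"
        using that by auto
      then show ?thesis using cau[of k l] K by linarith
    qed
    then show "\<exists>K. \<forall>k\<ge>K. \<forall>l\<ge>K. q (u k - u l) < e" by blast
  qed
  then obtain m where m: "m \<in> M" and lim: "(\<lambda>k. q (u k - m)) \<longlonglongrightarrow> 0" by blast
  have mV: "m \<in> V" using m MV by auto
  have "sqrt (q (w - m)) \<le> sqrt (q (w - u k)) + sqrt (q (u k - m))" for k
    using sqrt_triangle[of "w - u k" "u k - m"] w uV mV by simp
  moreover have "sqrt (q (w - u k)) \<le> sqrt (d + inverse (real (Suc k)))" for k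
    using u(2)[of k] by simp
  ultimately have le: "sqrt (q (w - m)) \<le> sqrt (d + inverse (real (Suc k))) + sqrt (q (u k - m))" for k
    by (meson add_right_mono order_trans)
  have "(\<lambda>k. sqrt (d + inverse (real (Suc k))) + sqrt (q (u k - m))) \<longlonglongrightarrow> sqrt (d + 0) + sqrt 0"
    using LIMSEQ_inverse_real_of_nat lim by (intro tendsto_intros)
  then have "sqrt (q (w - m)) \<le> sqrt (d + 0) + sqrt 0"
    by (rule LIMSEQ_le_const) (use le in auto)
  then have min: "q (w - m) \<le> d" by simp
  have "q (w - m + m') = q (w - m) + q m'" if m': "m' \<in> M" for m'
  proof -
    obtain r where r: "\<And>s. q ((w - m) + s *\<^sub>R m') = q (w - m) + 2 * s * r + s\<^sup>2 * q m'"
      using quadratic_expansion[of "w - m" m'] w mV MV[OF m'] by auto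
    have pos: "0 \<le> 2 * s * r + s\<^sup>2 * q m'" for s
    proof -
      have "m - s *\<^sub>R m' \<in> M" using m m' M by (intro subspace_diff subspace_scale)
      then have "d \<le> q (w - (m - s *\<^sub>R m'))" by (rule dle)
      also have "w - (m - s *\<^sub>R m') = (w - m) + s *\<^sub>R m'" by simp
      finally show ?thesis using r[of s] min by linarith
    qed
    have qm: "0 \<le> q m'" using nonneg MV m' by auto
    have "r = 0"
    proof (rule ccontr)
      assume "r \<noteq> 0"
      \<comment> \<open>The denominator \<open>q m' + 1\<close> instead of \<open>q m'\<close>
        treats the degenerate case \<open>q m' = 0\<close> at the same time.\<close>
      have "0 \<le> 2 * (- r / (q m' + 1)) * r + (- r / (q m' + 1))\<^sup>2 * q m'" by (rule pos)
      also have "\<dots> = - (r\<^sup>2 * (q m' + 2) / (q m' + 1)\<^sup>2)"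
        using qm by (simp add: power2_eq_square divide_simps) (simp add: algebra_simps)
      finally have "r\<^sup>2 * (q m' + 2) / (q m' + 1)\<^sup>2 \<le> 0" by simp
      moreover have "r\<^sup>2 * (q m' + 2) / (q m' + 1)\<^sup>2 > 0"
        using qm \<open>r \<noteq> 0\<close> by (intro divide_pos_pos mult_pos_pos) auto
      ultimately show False by simp
    qed
    then show ?thesis using r[of 1] by simp
  qed
  with m show ?thesis using that by blast
qed

end

section \<open>Geometry of a complex Hilbert space\<close>

locale hilbert_sp =
  fixes sc :: "complex \<Rightarrow> 'h::banach \<Rightarrow> 'h" and ip :: "'h \<Rightarrow> 'h \<Rightarrow> complex"
  assumes hilb: "complex_hilbert sc ip"
begin

lemma module_sc: "module sc"
  using hilb by (simp add: complex_hilbert_def)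

sublocale cv: vector_space sc
proof -
  interpret module sc by (rule module_sc)
  show "vector_space sc"
    by standard (simp_all add: scale_right_distrib scale_left_distrib)
qed

lemma sc_of_real [simp]: "sc (complex_of_real r) x = r *\<^sub>R x"
  and ip_add_left: "ip (x + y) z = ip x z + ip y z"
  and ip_sc_left: "ip (sc c x) y = c * ip x y"
  and ip_cnj: "ip y x = cnj (ip x y)"
  and ip_self: "ip x x = complex_of_real ((norm x)\<^sup>2)"
  using hilb unfolding complex_hilbert_def by blast+

lemma ip_add_right: "ip z (x + y) = ip z x + ip z y"
  using ip_cnj ip_add_left by (metis complex_cnj_add)

lemma ip_sc_right: "ip x (sc c y) = cnj c * ip x y"
  using ip_cnj ip_sc_left by (metis complex_cnj_mult)

lemma ip_scaleR_left: "ip (r *\<^sub>R x) y = complex_of_real r * ip x y"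
  using ip_sc_left[of "complex_of_real r" x y] by simp

lemma ip_scaleR_right: "ip x (r *\<^sub>R y) = complex_of_real r * ip x y"
  using ip_sc_right[of x "complex_of_real r" y] by simp

lemma ip_zero_left [simp]: "ip 0 y = 0"
  using ip_add_left[of 0 0 y] by simp

lemma ip_zero_right [simp]: "ip y 0 = 0"
  using ip_add_right[of y 0 0] by simp

lemma ip_minus_left: "ip (- x) y = - ip x y"
  using ip_add_left[of x "- x" y] by (simp add: add_eq_0_iff)

lemma ip_minus_right: "ip y (- x) = - ip y x"
  using ip_add_right[of y x "- x"] by (simp add: add_eq_0_iff)

lemma ip_diff_left: "ip (x - y) z = ip x z - ip y z"
  using ip_add_left[of x "- y" z] by (simp add: ip_minus_left)

lemma ip_diff_right: "ip z (x - y) = ip z x - ip z y"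
  using ip_add_right[of z x "- y"] by (simp add: ip_minus_right)

lemmas ip_simps = ip_add_left ip_add_right ip_diff_left ip_diff_right ip_minus_left ip_minus_right
  ip_scaleR_left ip_scaleR_right ip_sc_left ip_sc_right

lemma ip_eq_0_sym: "ip x y = 0 \<Longrightarrow> ip y x = 0"
  by (subst ip_cnj) simp

lemma Re_ip_commute: "Re (ip y x) = Re (ip x y)"
  by (subst ip_cnj) simp

lemma norm_sq: "(norm x)\<^sup>2 = Re (ip x x)"
  by (simp add: ip_self)

lemma norm_add_sq: "(norm (x + y))\<^sup>2 = (norm x)\<^sup>2 + 2 * Re (ip x y) + (norm y)\<^sup>2"
  unfolding norm_sq by (simp add: ip_simps Re_ip_commute[of y x])

lemma norm_diff_sq: "(norm (x - y))\<^sup>2 = (norm x)\<^sup>2 - 2 * Re (ip x y) + (norm y)\<^sup>2"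
  unfolding norm_sq by (simp add: ip_simps Re_ip_commute[of y x])

lemma norm_sc: "norm (sc c x) = cmod c * norm x"
proof -
  have "complex_of_real ((norm (sc c x))\<^sup>2) = ip (sc c x) (sc c x)" by (rule ip_self[symmetric])
  also have "\<dots> = c * cnj c * ip x x" by (simp add: ip_simps)
  also have "\<dots> = complex_of_real ((cmod c * norm x)\<^sup>2)"
    by (simp add: ip_self power_mult_distrib complex_mult_cnj cmod_power2)
  finally have "(norm (sc c x))\<^sup>2 = (cmod c * norm x)\<^sup>2" by (simp only: of_real_eq_iff)
  then show ?thesis by (simp add: power2_eq_iff_nonneg)
qed

lemma csubspace_real: "cv.subspace S \<Longrightarrow> subspace S"
  unfolding subspace_def cv.subspace_def by (metis sc_of_real)

lemma norm_quadratic: "nonneg_quadratic UNIV (\<lambda>x::'h. (norm x)\<^sup>2)"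
proof
  fix x y :: 'h and s :: real
  show "(norm (x + s *\<^sub>R y))\<^sup>2 = (1 - s) * (norm x)\<^sup>2 + (s\<^sup>2 - s) * (norm y)\<^sup>2 + s * (norm (x + y))\<^sup>2"
    unfolding norm_add_sq by (simp add: ip_simps power_mult_distrib algebra_simps)
qed auto

lemma Re_ip_le: "Re (ip x y) \<le> norm x * norm y"
proof -
  have "(norm (x + y))\<^sup>2 \<le> (norm x + norm y)\<^sup>2"
    by (intro power_mono norm_triangle_ineq) auto
  then show ?thesis unfolding norm_add_sq by (simp add: power2_sum)
qed

lemma Cauchy_Schwarz: "cmod (ip x y) \<le> norm x * norm y"
proof (cases "ip x y = 0")
  case False
  define c where "c = cnj (ip x y) / cmod (ip x y)"
  have "cmod c = 1" using False by (simp add: c_def norm_divide)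
  moreover have "Re (ip (sc c x) y) = cmod (ip x y)"
    using False by (simp add: c_def ip_simps complex_norm_square[symmetric] power2_eq_square mult.commute)
  ultimately show ?thesis using Re_ip_le[of "sc c x" y] by (simp add: norm_sc)
qed simp

lemma bounded_linear_ip_left: "bounded_linear (\<lambda>x. ip x y)"
  by (rule bounded_linear_intro[where K="norm y"])
    (auto simp: ip_simps scaleR_conv_of_real Cauchy_Schwarz)

lemma bounded_linear_ip_right: "bounded_linear (\<lambda>y. ip x y)"
  by (rule bounded_linear_intro[where K="norm x"])
    (auto simp: ip_simps scaleR_conv_of_real mult.commute[of _ "norm x"] Cauchy_Schwarz)

lemmas tendsto_ip_left = bounded_linear.tendsto[OF bounded_linear_ip_left]
  and tendsto_ip_right = bounded_linear.tendsto[OF bounded_linear_ip_right]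

lemma eq_if_ip_eq_dense:
  assumes "closure D = UNIV" "\<And>w. w \<in> D \<Longrightarrow> ip w x = ip w y"
  shows "x = y"
proof -
  obtain u where u: "\<And>n. u n \<in> D" "u \<longlonglongrightarrow> x - y"
    using assms(1) closure_sequential[of "x - y" D] by auto
  have "(\<lambda>n. ip (u n) (x - y)) \<longlonglongrightarrow> ip (x - y) (x - y)"
    using u(2) by (rule tendsto_ip_left)
  moreover have "(\<lambda>n. ip (u n) (x - y)) = (\<lambda>n. 0)" using assms(2) u(1) by (simp add: ip_simps)
  ultimately have "ip (x - y) (x - y) = 0" by (simp add: LIMSEQ_const_iff)
  then show ?thesis by (simp add: ip_self)
qed

text \<open>The vector is \<open>w\<close> minus its best approximation in \<open>R\<close>.
  Pythagoras for the norm only makes the real part of the inner product vanish; replacing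
  \<open>x\<close> by i times \<open>x\<close>, which stays in the complex subspace
  \<open>R\<close>, handles the imaginary part.\<close>

lemma orthogonal_vector_exists:
  assumes R: "cv.subspace R" "closed R" and w: "w \<notin> R"
  obtains v where "v \<noteq> 0" "\<And>x. x \<in> R \<Longrightarrow> ip x v = 0"
proof -
  interpret nonneg_quadratic UNIV "\<lambda>x::'h. (norm x)\<^sup>2" by (rule norm_quadratic)
  have comp: "\<exists>m\<in>R. (\<lambda>k. (norm (u k - m))\<^sup>2) \<longlonglongrightarrow> 0"
    if u: "\<And>k. u k \<in> R" and C: "\<And>e. e > 0 \<Longrightarrow> \<exists>K. \<forall>k\<ge>K. \<forall>l\<ge>K. (norm (u k - u l))\<^sup>2 < e" for u
  proof -
    have "Cauchy u"
    proof (rule CauchyI)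
      fix e :: real assume "0 < e"
      then obtain K where "\<forall>k\<ge>K. \<forall>l\<ge>K. (norm (u k - u l))\<^sup>2 < e\<^sup>2" using C[of "e\<^sup>2"] by auto
      then show "\<exists>K. \<forall>k\<ge>K. \<forall>l\<ge>K. norm (u k - u l) < e"
        using \<open>0 < e\<close> by (metis less_imp_le power2_less_imp_less)
    qed
    then obtain m where m: "u \<longlonglongrightarrow> m" using convergent_def Cauchy_convergent by blast
    then have "m \<in> R" using R(2) u closed_sequentially by blast
    moreover have "(\<lambda>k. (norm (u k - m))\<^sup>2) \<longlonglongrightarrow> (norm (m - m))\<^sup>2"
      using m by (intro tendsto_intros)
    ultimately show ?thesis by auto
  qed
  obtain m where m: "m \<in> R" "\<And>m'. m' \<in> R \<Longrightarrow> (norm (w - m + m'))\<^sup>2 = (norm (w - m))\<^sup>2 + (norm m')\<^sup>2"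
    using orthogonal_projection[OF csubspace_real[OF R(1)], of w] comp by auto
  have Re0: "Re (ip x (w - m)) = 0" if "x \<in> R" for x
    using m(2)[OF that] by (simp add: norm_add_sq Re_ip_commute[of x])
  have "ip x (w - m) = 0" if "x \<in> R" for x
  proof (rule complex_eqI)
    have "sc \<i> x \<in> R" using that R by (simp add: cv.subspace_scale)
    from Re0[OF this] show "Im (ip x (w - m)) = Im 0" by (simp add: ip_sc_left)
  qed (use Re0 that in auto)
  moreover have "w - m \<noteq> 0" using m w by auto
  ultimately show ?thesis using that by blast
qed

text \<open>Each orthogonality condition lowers the dimension by at most one, so fewer conditions
  than dimensions leave a nonzero solution. This produces the test vector in the upper bound for the
  triple variation.\<close>

lemma underdetermined_orthogonal:
  assumes "finite C" "finite B" "\<not> cv.dependent B" "card C < card B"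
  shows "\<exists>x\<in>cv.span B. x \<noteq> 0 \<and> (\<forall>y\<in>C. ip x y = 0)"
  using assms
proof (induction C arbitrary: B rule: finite_induct)
  case empty
  then obtain b where "b \<in> B" by fastforce
  moreover have "b \<noteq> 0" using \<open>b \<in> B\<close> empty.prems cv.dependent_zero by blast
  ultimately show ?case by (auto intro: cv.span_base)
next
  case (insert y C)
  let ?X = "{x\<in>cv.span B. ip x y = 0}"
  have sub: "cv.subspace ?X"
    unfolding cv.subspace_def by (auto simp: cv.span_zero cv.span_add cv.span_scale ip_simps)
  obtain B' where B': "B' \<subseteq> ?X" "\<not> cv.dependent B'" "?X \<subseteq> cv.span B'"
    using cv.maximal_independent_subset[of ?X] by blast
  have finB': "finite B'"
    using B' insert.prems cv.independent_span_bound[of B B'] by blast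
  \<comment> \<open>A single vector not annihilated by the new condition recovers the whole span
    from the kernel; if there is none, any vector serves.\<close>
  have "\<exists>b0. cv.span B \<subseteq> cv.span (insert b0 B')"
  proof (cases "\<forall>x\<in>cv.span B. ip x y = 0")
    case True
    then show ?thesis using B'(3) cv.span_mono[of B' "insert y B'"] by blast
  next
    case False
    then obtain b0 where b0: "b0 \<in> cv.span B" "ip b0 y \<noteq> 0" by blast
    have "x \<in> cv.span (insert b0 B')" if x: "x \<in> cv.span B" for x
    proof -
      define c where "c = ip x y / ip b0 y"
      have "x - sc c b0 \<in> ?X" using x b0 by (simp add: c_def ip_simps cv.span_diff cv.span_scale)
      then show ?thesis using B'(3) cv.span_breakdown_eq by blast
    qed
    then show ?thesis by blast
  qed
  then obtain b0 where b0: "cv.span B \<subseteq> cv.span (insert b0 B')" by blast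
  have "card B \<le> card (insert b0 B')"
    using cv.independent_span_bound[of "insert b0 B'" B] finB' insert.prems b0 cv.span_superset[of B] by auto
  also have "\<dots> \<le> Suc (card B')" by (rule card_insert_le_m1) auto
  finally have "card C < card B'" using insert by simp
  from insert.IH[OF finB' B'(2) this]
  obtain x where x: "x \<in> cv.span B'" "x \<noteq> 0" "\<forall>y\<in>C. ip x y = 0" by blast
  have "x \<in> ?X" using x(1) B'(1) sub cv.span_minimal by blast
  with x show ?case by auto
qed

end

section \<open>Projection-valued measures\<close>

locale spectral_resolution = hilbert_sp sc ip
  for sc :: "complex \<Rightarrow> 'h::banach \<Rightarrow> 'h" and ip :: "'h \<Rightarrow> 'h \<Rightarrow> complex" +
  fixes A :: "'h \<Rightarrow> 'h" and DA :: "'h set" and E :: "real set \<Rightarrow> 'h \<Rightarrow> 'h"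
  assumes sa: "selfadjoint sc ip A DA" and spec: "spectral_measure_of sc ip A DA E"
begin

abbreviation \<mu> :: "'h \<Rightarrow> real measure" where "\<mu> \<equiv> spec_mu ip E"

lemma
  assumes "S \<in> sets borel"
  shows E_add: "E S (x + y) = E S x + E S y"
    and E_sc: "E S (sc c x) = sc c (E S x)"
    and E_idem: "E S (E S x) = E S x"
    and E_sym: "ip (E S x) y = ip x (E S y)"
  using spec assms unfolding spectral_measure_of_def by auto

lemma E_UNIV [simp]: "E UNIV x = x" and E_empty [simp]: "E {} x = 0"
  using spec unfolding spectral_measure_of_def by auto

lemma E_Int: "S \<in> sets borel \<Longrightarrow> T \<in> sets borel \<Longrightarrow> E S (E T x) = E (S \<inter> T) x"
  using spec unfolding spectral_measure_of_def by auto

lemma E_scaleR: "S \<in> sets borel \<Longrightarrow> E S (r *\<^sub>R x) = r *\<^sub>R E S x"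
  using E_sc[of S "complex_of_real r" x] by simp

lemma E_zero [simp]: "S \<in> sets borel \<Longrightarrow> E S 0 = 0"
  using E_scaleR[of S 0 0] by simp

lemma E_minus: "S \<in> sets borel \<Longrightarrow> E S (- x) = - E S x"
  using E_scaleR[of S "-1" x] by simp

lemma E_diff: "S \<in> sets borel \<Longrightarrow> E S (x - y) = E S x - E S y"
  using E_add[of S x "- y"] by (simp add: E_minus)

lemma Re_ip_E: "S \<in> sets borel \<Longrightarrow> Re (ip (E S x) x) = (norm (E S x))\<^sup>2"
  unfolding norm_sq by (metis E_idem E_sym)

lemma space_\<mu> [simp]: "space (\<mu> x) = UNIV"
  and sets_\<mu> [simp, measurable_cong]: "sets (\<mu> x) = sets borel"
  unfolding spec_mu_def using sets.sigma_algebra_axioms[of "borel :: real measure"]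
  by (simp_all add: sigma_algebra.sigma_sets_eq space_measure_of_conv)

lemma emeasure_\<mu>: "S \<in> sets borel \<Longrightarrow> emeasure (\<mu> x) S = ennreal ((norm (E S x))\<^sup>2)"
proof -
  assume S: "S \<in> sets borel"
  have "emeasure (\<mu> x) S = ennreal (Re (ip (E S x) x))"
    unfolding spec_mu_def
  proof (rule emeasure_measure_of_sigma)
    show "sigma_algebra UNIV (sets (borel :: real measure))"
      using sets.sigma_algebra_axioms[of "borel :: real measure"] by simp
    show "positive (sets (borel :: real measure)) (\<lambda>S. ennreal (Re (ip (E S x) x)))"
      by (simp add: positive_def)
    show "countably_additive (sets (borel :: real measure)) (\<lambda>S. ennreal (Re (ip (E S x) x)))"
      using spec unfolding spectral_measure_of_def by blast
  qed fact
  then show ?thesis using S by (simp add: Re_ip_E)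
qed

lemma finite_measure_\<mu>: "finite_measure (\<mu> x)"
  by (rule finite_measureI) (simp add: emeasure_\<mu>)

lemma measure_\<mu>: "S \<in> sets borel \<Longrightarrow> measure (\<mu> x) S = (norm (E S x))\<^sup>2"
  by (simp add: measure_def emeasure_\<mu>)

lemma integrable_const_\<mu> [simp]: "integrable (\<mu> x) (\<lambda>t. c :: real)"
  by (simp add: finite_measure.integrable_const finite_measure_\<mu>)

lemma measure_\<mu>_UNIV [simp]: "measure (\<mu> x) UNIV = (norm x)\<^sup>2"
  by (simp add: measure_\<mu>)

lemma integral_const_\<mu>: "(\<integral>t. c \<partial>\<mu> x) = c * (norm x)\<^sup>2"
  by simp

lemma norm_E_le: "S \<in> sets borel \<Longrightarrow> norm (E S x) \<le> norm x"
proof -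
  assume S: "S \<in> sets borel"
  have "norm (E S x) * norm (E S x) \<le> norm (E S x) * norm x"
    using Re_ip_E[OF S, of x] Re_ip_le[of "E S x" x] by (simp add: power2_eq_square)
  then show ?thesis by (cases "norm (E S x) = 0") auto
qed

lemma E_orthogonal:
  assumes "S \<in> sets borel" "T \<in> sets borel" "S \<inter> T = {}"
  shows "ip (E S x) (E T y) = 0"
  using assms by (simp add: E_sym E_Int)

text \<open>Only the scalar measures are known to be additive. The vector identity follows because
  additivity and the orthogonality of the two ranges make the squared norm of the difference
  vanish.\<close>

lemma E_Compl:
  assumes S: "S \<in> sets borel"
  shows "E (- S) x = x - E S x"
proof -
  have S': "- S \<in> sets borel" using S by auto
  have "measure (\<mu> x) (S \<union> - S) = measure (\<mu> x) S + measure (\<mu> x) (- S)"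
    using S S' by (intro finite_measure.finite_measure_Union finite_measure_\<mu>) auto
  then have *: "(norm x)\<^sup>2 = (norm (E S x))\<^sup>2 + (norm (E (- S) x))\<^sup>2"
    using S S' by (simp add: measure_\<mu>)
  have "(norm (x - E S x - E (- S) x))\<^sup>2
      = (norm x)\<^sup>2 - (norm (E S x))\<^sup>2 - (norm (E (- S) x))\<^sup>2"
    unfolding norm_diff_sq
    using E_orthogonal[OF S S', of x x] Re_ip_E[OF S, of x] Re_ip_E[OF S', of x]
    by (simp add: ip_simps Re_ip_commute[of x])
  then have "x - E S x - E (- S) x = 0" using * by simp
  then show ?thesis by simp
qed

lemma E_Un:
  assumes S: "S \<in> sets borel" and T: "T \<in> sets borel" and "S \<inter> T = {}"
  shows "E (S \<union> T) x = E S x + E T x"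
proof -
  have "E (S \<union> T) x = E S (E (S \<union> T) x) + E (- S) (E (S \<union> T) x)"
    using E_Compl[OF S] by simp
  also have "E S (E (S \<union> T) x) = E S x"
    using S T by (simp add: E_Int Int_absorb2)
  also have "E (- S) (E (S \<union> T) x) = E T x"
  proof -
    have "- S \<inter> (S \<union> T) = T" using assms(3) by auto
    then show ?thesis using E_Int[of "- S" "S \<union> T"] S T by auto
  qed
  finally show ?thesis .
qed

lemma E_subset:
  assumes "S \<in> sets borel" "T \<in> sets borel" "S \<subseteq> T"
  shows "E S (E T x) = E S x" "E T (E S x) = E S x"
  using assms by (simp_all add: E_Int Int_absorb2 Int_absorb1)

lemma E_fix_mono:
  assumes "S \<in> sets borel" "T \<in> sets borel" "S \<subseteq> T" "E S x = x"
  shows "E T x = x"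
  using E_subset(2)[OF assms(1-3), of x] assms(4) by simp

lemma E_fix_disjoint:
  assumes "S \<in> sets borel" "T \<in> sets borel" "S \<inter> T = {}" "E S x = x"
  shows "E T x = 0"
  using E_Int[OF assms(2,1), of x] assms by (simp add: Int_commute)

lemma E_null_mono:
  assumes "S \<in> sets borel" "T \<in> sets borel" "S \<subseteq> T" "E T x = 0"
  shows "E S x = 0"
  using E_subset(1)[OF assms(1-3), of x] assms by simp

lemma E_zero_iff: "S \<in> sets borel \<Longrightarrow> E S x = 0 \<longleftrightarrow> S \<in> null_sets (\<mu> x)"
  by (auto simp: null_sets_def emeasure_\<mu>)

lemma E_null_UN:
  assumes "countable I" "\<And>i. i \<in> I \<Longrightarrow> F i \<in> sets borel" "\<And>i. i \<in> I \<Longrightarrow> E (F i) x = 0"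
  shows "E (\<Union>i\<in>I. F i) x = 0"
proof -
  have "(\<Union>i\<in>I. F i) \<in> null_sets (\<mu> x)"
    using assms by (intro null_sets_UN') (auto simp: E_zero_iff)
  then show ?thesis using E_zero_iff[of "\<Union>i\<in>I. F i" x] null_setsD2 by fastforce
qed

lemma AE_\<mu>_mem:
  assumes "S \<in> sets borel" "E S x = x"
  shows "AE t in \<mu> x. t \<in> S"
proof (rule AE_I[where N="- S"])
  show "emeasure (\<mu> x) (- S) = 0" using assms by (simp add: emeasure_\<mu> E_Compl)
qed (use assms in auto)

lemma csubspace_fix: "S \<in> sets borel \<Longrightarrow> cv.subspace {x. E S x = x}"
  unfolding cv.subspace_def by (simp add: E_add E_sc)

lemma span_fix:
  assumes "S \<in> sets borel" "\<And>b. b \<in> B \<Longrightarrow> E S b = b" "x \<in> cv.span B"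
  shows "E S x = x"
  using cv.span_minimal[OF _ csubspace_fix[OF assms(1)], of B] assms by auto

text \<open>The transfer principle: a finite linear relation between the measures of several vectors
  passes to integrals, by induction on \<open>f\<close> for all entries at once. Coefficients may be
  negative, so the integrals are kept finite by assuming integrability for every entry.\<close>

lemma spec_integral_linear_nonneg:
  fixes f :: "real \<Rightarrow> real" and xs :: "(real \<times> 'h) list"
  assumes "f \<in> borel_measurable borel" "\<And>t. 0 \<le> f t"
    and "\<And>a u. (a, u) \<in> set xs \<Longrightarrow> integrable (\<mu> u) f"
    and "\<And>S. S \<in> sets borel \<Longrightarrow> (\<Sum>(a,u)\<leftarrow>xs. a * (norm (E S u))\<^sup>2) = 0"
  shows "(\<Sum>(a,u)\<leftarrow>xs. a * (\<integral>t. f t \<partial>\<mu> u)) = 0"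
  using assms(1-3)
proof (induction rule: borel_measurable_induct_real)
  case (set S)
  then show ?case using assms(4)[of S] by (simp add: measure_\<mu>)
next
  case (mult f c)
  show ?case
  \<comment> \<open>For \<open>c = 0\<close> integrability of \<open>c * f\<close> says nothing
    about \<open>f\<close>, and the induction hypothesis is out of reach.\<close>
  proof (cases "c = 0")
    case False
    then have "integrable (\<mu> u) f" if "(a, u) \<in> set xs" for a u
      using mult.prems[OF that] by simp
    then have "(\<Sum>(a,u)\<leftarrow>xs. a * (\<integral>t. f t \<partial>\<mu> u)) = 0" by (rule mult.IH)
    moreover have "(\<Sum>(a,u)\<leftarrow>xs. a * (\<integral>t. c * f t \<partial>\<mu> u)) = c * (\<Sum>(a,u)\<leftarrow>xs. a * (\<integral>t. f t \<partial>\<mu> u))"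
      unfolding sum_list_const_mult[symmetric]
      by (intro arg_cong[where f=sum_list] map_cong) (auto simp: algebra_simps)
    ultimately show ?thesis by simp
  qed (simp add: case_prod_beta)
next
  case (add g f)
  have int: "integrable (\<mu> u) f" "integrable (\<mu> u) g" if "(a, u) \<in> set xs" for a u
    using add.hyps by (auto intro!: Bochner_Integration.integrable_bound[OF add.prems[OF that]])
  have "(\<Sum>(a,u)\<leftarrow>xs. a * (\<integral>t. f t + g t \<partial>\<mu> u)) =
      (\<Sum>(a,u)\<leftarrow>xs. a * (\<integral>t. f t \<partial>\<mu> u)) + (\<Sum>(a,u)\<leftarrow>xs. a * (\<integral>t. g t \<partial>\<mu> u))"
    unfolding sum_list_addf[symmetric]
    using int by (intro arg_cong[where f=sum_list] map_cong) (auto simp: algebra_simps)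
  then show ?case using add.IH int by simp
next
  case (seq U)
  have le: "U i t \<le> f t" for i t
    using seq.hyps by (intro incseq_le) (auto simp: incseq_def le_fun_def)
  have int: "integrable (\<mu> u) (U i)" if "(a, u) \<in> set xs" for a u i
    by (rule Bochner_Integration.integrable_bound[OF seq.prems[OF that]])
      (use seq.hyps le assms(2) in auto)
  have lim: "(\<lambda>i. \<integral>t. U i t \<partial>\<mu> u) \<longlonglongrightarrow> (\<integral>t. f t \<partial>\<mu> u)" if "(a, u) \<in> set xs" for a u
    using seq.hyps le assms(1) seq.prems[OF that]
    by (intro integral_dominated_convergence[where w=f]) auto
  have "(\<lambda>i. \<Sum>(a,u)\<leftarrow>ys. a * (\<integral>t. U i t \<partial>\<mu> u)) \<longlonglongrightarrow> (\<Sum>(a,u)\<leftarrow>ys. a * (\<integral>t. f t \<partial>\<mu> u))"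
    if "set ys \<subseteq> set xs" for ys
    using that
  proof (induction ys)
    case (Cons p ys)
    then show ?case using lim[of "fst p" "snd p"]
      by (auto simp: case_prod_beta intro!: tendsto_intros)
  qed simp
  from this[of xs] show ?case using seq.IH int by (simp add: LIMSEQ_const_iff)
qed

lemma spec_integral_linear:
  fixes f :: "real \<Rightarrow> real" and xs :: "(real \<times> 'h) list"
  assumes f: "f \<in> borel_measurable borel"
    and int: "\<And>a u. (a, u) \<in> set xs \<Longrightarrow> integrable (\<mu> u) f"
    and eq: "\<And>S. S \<in> sets borel \<Longrightarrow> (\<Sum>(a,u)\<leftarrow>xs. a * (norm (E S u))\<^sup>2) = 0"
  shows "(\<Sum>(a,u)\<leftarrow>xs. a * (\<integral>t. f t \<partial>\<mu> u)) = 0"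
proof -
  have split: "(\<integral>t. f t \<partial>\<mu> u) = (\<integral>t. max 0 (f t) \<partial>\<mu> u) - (\<integral>t. max 0 (- f t) \<partial>\<mu> u)"
    if "(a, u) \<in> set xs" for a u
  proof -
    have "(\<integral>t. max 0 (f t) - max 0 (- f t) \<partial>\<mu> u) = (\<integral>t. max 0 (f t) \<partial>\<mu> u) - (\<integral>t. max 0 (- f t) \<partial>\<mu> u)"
      using int[OF that] by (intro Bochner_Integration.integral_diff integrable_max) auto
    moreover have "(\<lambda>t. max 0 (f t) - max 0 (- f t)) = f" by auto
    ultimately show ?thesis by simp
  qed
  have "(\<Sum>(a,u)\<leftarrow>xs. a * (\<integral>t. max 0 (f t) \<partial>\<mu> u)) = 0"
    "(\<Sum>(a,u)\<leftarrow>xs. a * (\<integral>t. max 0 (- f t) \<partial>\<mu> u)) = 0"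
    by (rule spec_integral_linear_nonneg; use assms in auto)+
  moreover have "(\<Sum>(a,u)\<leftarrow>xs. a * (\<integral>t. f t \<partial>\<mu> u)) =
      (\<Sum>(a,u)\<leftarrow>xs. a * (\<integral>t. max 0 (f t) \<partial>\<mu> u)) - (\<Sum>(a,u)\<leftarrow>xs. a * (\<integral>t. max 0 (- f t) \<partial>\<mu> u))"
    unfolding sum_list_subtractf[symmetric]
    by (intro arg_cong[where f=sum_list] map_cong) (auto simp: split right_diff_distrib)
  ultimately show ?thesis by simp
qed

text \<open>Integrability at \<open>z\<close> is what has to be derived, so the comparison of
  measures is carried over to extended non-negative integrals. It shows that domains are stable
  under sums, scalars and spectral projections.\<close>

lemma nn_integral_\<mu>_dominated:
  fixes f :: "real \<Rightarrow> ennreal"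
  assumes "f \<in> borel_measurable borel" and c: "0 \<le> c"
    and dom: "\<And>S. S \<in> sets borel \<Longrightarrow> (norm (E S z))\<^sup>2 \<le> c * ((norm (E S x))\<^sup>2 + (norm (E S y))\<^sup>2)"
  shows "(\<integral>\<^sup>+t. f t \<partial>\<mu> z) \<le> ennreal c * ((\<integral>\<^sup>+t. f t \<partial>\<mu> x) + (\<integral>\<^sup>+t. f t \<partial>\<mu> y))"
  using assms(1)
proof (induction rule: borel_measurable_induct)
  case (cong f g)
  then show ?case by (simp cong: nn_integral_cong)
next
  case (set S)
  then show ?case using dom[OF set] c
    by (simp add: emeasure_\<mu> ennreal_plus[symmetric] ennreal_mult[symmetric] del: ennreal_plus)
next
  case (mult u d)
  have "d * (\<integral>\<^sup>+t. u t \<partial>\<mu> z) \<le> d * (ennreal c * ((\<integral>\<^sup>+t. u t \<partial>\<mu> x) + (\<integral>\<^sup>+t. u t \<partial>\<mu> y)))"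
    by (intro mult_left_mono mult.IH) simp
  with mult.hyps show ?case by (simp add: nn_integral_cmult algebra_simps)
next
  case (add u v)
  have "(\<integral>\<^sup>+t. v t \<partial>\<mu> z) + (\<integral>\<^sup>+t. u t \<partial>\<mu> z) \<le>
    ennreal c * ((\<integral>\<^sup>+t. v t \<partial>\<mu> x) + (\<integral>\<^sup>+t. v t \<partial>\<mu> y)) +
    ennreal c * ((\<integral>\<^sup>+t. u t \<partial>\<mu> x) + (\<integral>\<^sup>+t. u t \<partial>\<mu> y))"
    by (intro add_mono add.IH)
  with add.hyps show ?case by (simp add: nn_integral_add algebra_simps)
next
  case (seq U)
  have "(\<integral>\<^sup>+t. (SUP i. U i t) \<partial>\<mu> z) = (SUP i. \<integral>\<^sup>+t. U i t \<partial>\<mu> z)"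
    using seq.hyps by (intro nn_integral_monotone_convergence_SUP) auto
  also have "\<dots> \<le> ennreal c * ((\<integral>\<^sup>+t. (SUP i. U i t) \<partial>\<mu> x) + (\<integral>\<^sup>+t. (SUP i. U i t) \<partial>\<mu> y))"
  proof (rule SUP_least)
    fix i
    have "(\<integral>\<^sup>+t. U i t \<partial>\<mu> u) \<le> (\<integral>\<^sup>+t. (SUP i. U i t) \<partial>\<mu> u)" for u
      by (intro nn_integral_mono SUP_upper) auto
    then show "(\<integral>\<^sup>+t. U i t \<partial>\<mu> z) \<le> ennreal c * ((\<integral>\<^sup>+t. (SUP i. U i t) \<partial>\<mu> x) + (\<integral>\<^sup>+t. (SUP i. U i t) \<partial>\<mu> y))"
      by (intro order_trans[OF seq.IH[of i]] mult_left_mono add_mono) auto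
  qed
  finally show ?case by (simp add: image_comp)
qed

lemma integrable_\<mu>_dominated:
  fixes f :: "real \<Rightarrow> real"
  assumes "integrable (\<mu> x) f" "integrable (\<mu> y) f" "0 \<le> c"
    and "\<And>S. S \<in> sets borel \<Longrightarrow> (norm (E S z))\<^sup>2 \<le> c * ((norm (E S x))\<^sup>2 + (norm (E S y))\<^sup>2)"
  shows "integrable (\<mu> z) f"
proof (rule integrableI_bounded)
  have f: "f \<in> borel_measurable borel" using assms(1) by auto
  show "f \<in> borel_measurable (\<mu> z)" using f by simp
  have "(\<integral>\<^sup>+t. ennreal (norm (f t)) \<partial>\<mu> z) \<le>
     ennreal c * ((\<integral>\<^sup>+t. ennreal (norm (f t)) \<partial>\<mu> x) + (\<integral>\<^sup>+t. ennreal (norm (f t)) \<partial>\<mu> y))"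
    using f assms by (intro nn_integral_\<mu>_dominated) auto
  also have "\<dots> < \<infinity>"
    using assms(1,2) by (auto simp: integrable_iff_bounded ennreal_mult_less_top)
  finally show "(\<integral>\<^sup>+t. ennreal (norm (f t)) \<partial>\<mu> z) < \<infinity>" .
qed

lemma integrable_\<mu>_add:
  fixes f :: "real \<Rightarrow> real"
  assumes "integrable (\<mu> x) f" "integrable (\<mu> y) f"
  shows "integrable (\<mu> (x + y)) f"
proof (rule integrable_\<mu>_dominated[OF assms, of 2])
  fix S :: "real set" assume S: "S \<in> sets borel"
  \<comment> \<open>The parallelogram law with this term dropped is the source of the constant
    2.\<close>
  have "0 \<le> (norm (E S x - E S y))\<^sup>2" by simp
  then show "(norm (E S (x + y)))\<^sup>2 \<le> 2 * ((norm (E S x))\<^sup>2 + (norm (E S y))\<^sup>2)"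
    using S by (simp add: E_add norm_add_sq norm_diff_sq)
qed simp

lemma integrable_\<mu>_sc:
  fixes f :: "real \<Rightarrow> real"
  assumes "integrable (\<mu> x) f"
  shows "integrable (\<mu> (sc c x)) f"
  by (rule integrable_\<mu>_dominated[OF assms assms, of "(cmod c)\<^sup>2"])
    (auto simp: E_sc norm_sc power_mult_distrib algebra_simps)

lemma integrable_\<mu>_scaleR:
  fixes f :: "real \<Rightarrow> real"
  shows "integrable (\<mu> x) f \<Longrightarrow> integrable (\<mu> (c *\<^sub>R x)) f"
  using integrable_\<mu>_sc[of x f "complex_of_real c"] by simp

lemma integrable_\<mu>_E:
  fixes f :: "real \<Rightarrow> real"
  assumes "integrable (\<mu> x) f" "S \<in> sets borel"
  shows "integrable (\<mu> (E S x)) f"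
proof (rule integrable_\<mu>_dominated[OF assms(1,1), of 1])
  fix T :: "real set" assume T: "T \<in> sets borel"
  have "norm (E T (E S x)) = norm (E S (E T x))"
    using T assms by (simp add: E_Int Int_commute)
  also have "\<dots> \<le> norm (E T x)" using assms by (simp add: norm_E_le)
  finally have "(norm (E T (E S x)))\<^sup>2 \<le> (norm (E T x))\<^sup>2" by (intro power_mono) auto
  then show "(norm (E T (E S x)))\<^sup>2 \<le> 1 * ((norm (E T x))\<^sup>2 + (norm (E T x))\<^sup>2)"
    using zero_le_power2[of "norm (E T x)"] by (simp only: mult_1)
qed simp

lemma csubspace_integrable:
  fixes f :: "real \<Rightarrow> real"
  assumes "f \<in> borel_measurable borel"
  shows "cv.subspace {x. integrable (\<mu> x) f}"
  unfolding cv.subspace_def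
proof (intro conjI ballI allI)
  have "integrable (\<mu> 0) f"
  proof (rule integrableI_bounded)
    have "AE t in \<mu> 0. False" using AE_\<mu>_mem[of "{}" 0] by simp
    then have "(\<integral>\<^sup>+t. ennreal (norm (f t)) \<partial>\<mu> 0) = 0"
      using assms by (subst nn_integral_0_iff_AE) auto
    then show "(\<integral>\<^sup>+t. ennreal (norm (f t)) \<partial>\<mu> 0) < \<infinity>" by simp
  qed (use assms in simp)
  then show "0 \<in> {x. integrable (\<mu> x) f}" by simp
qed (auto intro: integrable_\<mu>_add integrable_\<mu>_sc)

lemma integral_\<mu>_sc:
  fixes f :: "real \<Rightarrow> real"
  assumes "integrable (\<mu> x) f"
  shows "(\<integral>t. f t \<partial>\<mu> (sc c x)) = (cmod c)\<^sup>2 * (\<integral>t. f t \<partial>\<mu> x)"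
proof -
  have "(\<Sum>(a,u)\<leftarrow>[(1, sc c x), (- (cmod c)\<^sup>2, x)]. a * (\<integral>t. f t \<partial>\<mu> u)) = 0"
  proof (rule spec_integral_linear)
    fix a u assume "(a, u) \<in> set [(1, sc c x), (- (cmod c)\<^sup>2, x)]"
    then show "integrable (\<mu> u) f" using assms by (auto intro: integrable_\<mu>_sc)
  qed (use assms in \<open>auto simp: E_sc norm_sc power_mult_distrib\<close>)
  then show ?thesis by simp
qed

lemma integral_\<mu>_quadratic:
  fixes f :: "real \<Rightarrow> real"
  assumes "integrable (\<mu> x) f" "integrable (\<mu> y) f"
  shows "(\<integral>t. f t \<partial>\<mu> (x + s *\<^sub>R y)) =
    (1 - s) * (\<integral>t. f t \<partial>\<mu> x) + (s\<^sup>2 - s) * (\<integral>t. f t \<partial>\<mu> y) + s * (\<integral>t. f t \<partial>\<mu> (x + y))"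
proof -
  interpret nonneg_quadratic UNIV "\<lambda>x::'h. (norm x)\<^sup>2" by (rule norm_quadratic)
  have "(\<Sum>(a,u)\<leftarrow>[(1, x + s *\<^sub>R y), (- (1 - s), x), (- (s\<^sup>2 - s), y), (- s, x + y)]. a * (\<integral>t. f t \<partial>\<mu> u)) = 0"
  proof (rule spec_integral_linear)
    show "f \<in> borel_measurable borel" using assms(1) by auto
  next
    fix a u assume "(a, u) \<in> set [(1, x + s *\<^sub>R y), (- (1 - s), x), (- (s\<^sup>2 - s), y), (- s, x + y)]"
    then show "integrable (\<mu> u) f" using assms by (auto intro: integrable_\<mu>_add integrable_\<mu>_scaleR)
  next
    fix S :: "real set" assume "S \<in> sets borel"
    then show "(\<Sum>(a,u)\<leftarrow>[(1, x + s *\<^sub>R y), (- (1 - s), x), (- (s\<^sup>2 - s), y), (- s, x + y)]. a * (norm (E S u))\<^sup>2) = 0"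
      using quad[of "E S x" "E S y" s] by (simp add: E_add E_scaleR algebra_simps)
  qed
  then show ?thesis by (simp add: algebra_simps)
qed

text \<open>For every \<open>T\<close> the vectors \<open>E T x\<close> and \<open>E T y\<close> are
  orthogonal, so the measure of \<open>x + y\<close> is the sum of the two measures.\<close>

lemma integral_\<mu>_split:
  fixes f :: "real \<Rightarrow> real"
  assumes "integrable (\<mu> x) f" "integrable (\<mu> y) f" "S \<in> sets borel" "E S x = x" "E (- S) y = y"
  shows "(\<integral>t. f t \<partial>\<mu> (x + y)) = (\<integral>t. f t \<partial>\<mu> x) + (\<integral>t. f t \<partial>\<mu> y)"
proof -
  have "(\<Sum>(a,u)\<leftarrow>[(1, x + y), (-1, x), (-1, y)]. a * (\<integral>t. f t \<partial>\<mu> u)) = 0"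
  proof (rule spec_integral_linear)
    show "f \<in> borel_measurable borel" using assms(1) by auto
  next
    fix a u assume "(a, u) \<in> set [(1, x + y), (-1, x), (-1, y)]"
    then show "integrable (\<mu> u) f" using assms by (auto intro: integrable_\<mu>_add)
  next
    fix T :: "real set" assume T: "T \<in> sets borel"
    have "ip (E T x) (E T y) = ip (E (T \<inter> S) x) (E (T \<inter> - S) y)"
      using E_Int[OF T assms(3), of x] E_Int[OF T, of "- S" y] assms(3,4,5) by auto
    also have "\<dots> = 0" using T assms(3) by (intro E_orthogonal) auto
    finally show "(\<Sum>(a,u)\<leftarrow>[(1, x + y), (-1, x), (-1, y)]. a * (norm (E T u))\<^sup>2) = 0"
      using T by (simp add: E_add norm_add_sq)
  qed
  then show ?thesis by simp
qed

end

section \<open>Maximal non-negative subspaces\<close>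

context spectral_resolution
begin

text \<open>Lower semicontinuity of a possibly unbounded form under norm convergence. For the
  truncation at height \<open>k\<close> the square root of the form is Lipschitz with constant
  \<open>sqrt (real k)\<close>, so the bound passes to the limit vector; monotone convergence then
  removes the truncation.\<close>

lemma integral_\<mu>_lsc:
  fixes f :: "real \<Rightarrow> real"
  assumes f: "f \<in> borel_measurable borel" "\<And>t. 0 \<le> f t" and u: "u \<longlonglongrightarrow> x"
    and bound: "\<And>n. n \<ge> K \<Longrightarrow> integrable (\<mu> (u n)) f \<and> (\<integral>t. f t \<partial>\<mu> (u n)) \<le> C"
  shows "integrable (\<mu> x) f" "(\<integral>t. f t \<partial>\<mu> x) \<le> C"
proof -
  define g where "g k t = min (f t) (real k)" for k t
  have g_meas: "g k \<in> borel_measurable borel" for k unfolding g_def using f by simp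
  have g_bd: "0 \<le> g k t" "g k t \<le> real k" "g k t \<le> f t" for k t using f by (auto simp: g_def)
  have g_int: "integrable (\<mu> v) (g k)" for v k
    by (rule Bochner_Integration.integrable_bound[OF integrable_const_\<mu>[of v "real k"]])
      (use g_meas g_bd in auto)
  have g_le: "(\<integral>t. g k t \<partial>\<mu> x) \<le> C" for k
  proof -
    define q where "q v = (\<integral>t. g k t \<partial>\<mu> v)" for v
    interpret nonneg_quadratic UNIV q
      by standard (auto simp: q_def integral_\<mu>_quadratic g_int g_bd intro!: integral_nonneg_AE)
    have q_le: "q v \<le> real k * (norm v)\<^sup>2" for v
      unfolding q_def integral_const_\<mu>[of v "real k", symmetric]
      by (rule integral_mono) (use g_int g_bd in auto)
    have "(\<lambda>n. sqrt (q (u n))) \<longlonglongrightarrow> sqrt (q x)"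
    proof (rule LIM_zero_cancel, rule Lim_null_comparison)
      show "\<forall>\<^sub>F n in sequentially. norm (sqrt (q (u n)) - sqrt (q x)) \<le> sqrt (real k) * norm (u n - x)"
      proof (rule always_eventually, rule allI)
        fix n
        have "sqrt (q (u n - x)) \<le> sqrt (real k * (norm (u n - x))\<^sup>2)"
          using q_le by simp
        then show "norm (sqrt (q (u n)) - sqrt (q x)) \<le> sqrt (real k) * norm (u n - x)"
          using sqrt_diff[of "u n" x] by (simp add: real_sqrt_mult)
      qed
      have "(\<lambda>n. sqrt (real k) * norm (u n - x)) \<longlonglongrightarrow> sqrt (real k) * norm (x - x)"
        using u by (intro tendsto_intros)
      then show "(\<lambda>n. sqrt (real k) * norm (u n - x)) \<longlonglongrightarrow> 0" by simp
    qed
    then have "(\<lambda>n. (sqrt (q (u n)))\<^sup>2) \<longlonglongrightarrow> (sqrt (q x))\<^sup>2" by (rule tendsto_power)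
    then have "(\<lambda>n. q (u n)) \<longlonglongrightarrow> q x" using nonneg by simp
    moreover have "q (u n) \<le> C" if "n \<ge> K" for n
    proof -
      have "q (u n) \<le> (\<integral>t. f t \<partial>\<mu> (u n))"
        unfolding q_def by (rule integral_mono) (use g_int g_bd bound[OF that] in auto)
      then show ?thesis using bound[OF that] by simp
    qed
    ultimately have "q x \<le> C" by (intro LIMSEQ_le_const2) auto
    then show ?thesis by (simp add: q_def)
  qed
  have inc: "incseq (\<lambda>k. \<integral>t. g k t \<partial>\<mu> x)"
    by (intro incseq_SucI integral_mono g_int) (auto simp: g_def)
  then obtain L where L: "(\<lambda>k. \<integral>t. g k t \<partial>\<mu> x) \<longlonglongrightarrow> L"
    using incseq_convergent[of "\<lambda>k. \<integral>t. g k t \<partial>\<mu> x" C] g_le by blast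
  have pt: "AE t in \<mu> x. (\<lambda>k. g k t) \<longlonglongrightarrow> f t"
  proof (rule AE_I2)
    fix t
    obtain k0 :: nat where "f t \<le> real k0" using real_arch_simple by blast
    then have "eventually (\<lambda>k. g k t = f t) sequentially"
      unfolding g_def eventually_sequentially by (intro exI[of _ k0]) auto
    then show "(\<lambda>k. g k t) \<longlonglongrightarrow> f t" by (rule tendsto_eventually)
  qed
  have mono: "AE t in \<mu> x. mono (\<lambda>k. g k t)"
    by (rule AE_I2) (auto simp: g_def mono_def)
  have "integrable (\<mu> x) f \<and> (\<integral>t. f t \<partial>\<mu> x) = L"
    using integrable_monotone_convergence[OF g_int mono pt L]
      integral_monotone_convergence[OF g_int mono pt L] f by auto
  moreover have "L \<le> C" using L g_le by (intro LIMSEQ_le_const2) auto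
  ultimately show "integrable (\<mu> x) f" "(\<integral>t. f t \<partial>\<mu> x) \<le> C" by auto
qed

end

section \<open>Positive and negative parts of the form shifted by a point in a spectral gap\<close>

locale spectral_gap = spectral_resolution sc ip A DA E
  for sc :: "complex \<Rightarrow> 'h::banach \<Rightarrow> 'h" and ip :: "'h \<Rightarrow> 'h \<Rightarrow> complex"
    and A :: "'h \<Rightarrow> 'h" and DA :: "'h set" and E :: "real set \<Rightarrow> 'h \<Rightarrow> 'h" +
  fixes \<gamma> \<delta> :: real
  assumes \<delta>: "\<delta> > 0" and gap: "E {\<gamma> - \<delta><..<\<gamma> + \<delta>} x = 0"
begin

abbreviation "D \<equiv> form_dom ip E"

text \<open>The shifted form is \<open>qp - qm\<close> on \<open>D\<close>. Each part is
  non-negative, so unlike the difference it has a triangle inequality.\<close>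

definition qp :: "'h \<Rightarrow> real" where "qp x = (\<integral>t. max 0 (t - \<gamma>) \<partial>\<mu> x)"
definition qm :: "'h \<Rightarrow> real" where "qm x = (\<integral>t. max 0 (\<gamma> - t) \<partial>\<mu> x)"

lemma csubspace_D: "cv.subspace D"
  unfolding form_dom_def by (rule csubspace_integrable) simp

lemma integrable_qp: "x \<in> D \<Longrightarrow> integrable (\<mu> x) (\<lambda>t. max 0 (t - \<gamma>))"
  and integrable_qm: "x \<in> D \<Longrightarrow> integrable (\<mu> x) (\<lambda>t. max 0 (\<gamma> - t))"
  unfolding form_dom_def by (auto intro!: integrable_max)

lemma D_I:
  assumes "integrable (\<mu> x) (\<lambda>t. max 0 (t - \<gamma>))" "integrable (\<mu> x) (\<lambda>t. max 0 (\<gamma> - t))"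
  shows "x \<in> D"
proof -
  have "integrable (\<mu> x) (\<lambda>t. max 0 (t - \<gamma>) - max 0 (\<gamma> - t) + \<gamma>)" using assms by simp
  moreover have "(\<lambda>t. max 0 (t - \<gamma>) - max 0 (\<gamma> - t) + \<gamma>) = (\<lambda>t. t)" by (auto simp: max_def)
  ultimately show ?thesis by (simp add: form_dom_def)
qed

lemma form_q_eq:
  assumes "x \<in> D"
  shows "form_q ip E x - \<gamma> * (norm x)\<^sup>2 = qp x - qm x"
proof -
  have "form_q ip E x - \<gamma> * (norm x)\<^sup>2 = (\<integral>t. t - \<gamma> \<partial>\<mu> x)"
    using assms by (simp add: form_dom_def form_q_def)
  also have "(\<lambda>t. t - \<gamma>) = (\<lambda>t. max 0 (t - \<gamma>) - max 0 (\<gamma> - t))" by (auto simp: max_def)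
  also have "(\<integral>t. max 0 (t - \<gamma>) - max 0 (\<gamma> - t) \<partial>\<mu> x) = qp x - qm x"
    unfolding qp_def qm_def using integrable_qp integrable_qm assms
    by (intro Bochner_Integration.integral_diff) auto
  finally show ?thesis .
qed

sublocale qp: nonneg_quadratic D qp
  by standard (auto simp: qp_def integral_\<mu>_quadratic integrable_qp csubspace_D
      intro!: csubspace_real integral_nonneg_AE)

sublocale qm: nonneg_quadratic D qm
  by standard (auto simp: qm_def integral_\<mu>_quadratic integrable_qm csubspace_D
      intro!: csubspace_real integral_nonneg_AE)

lemma qp_sc: "x \<in> D \<Longrightarrow> qp (sc c x) = (cmod c)\<^sup>2 * qp x"
  and qm_sc: "x \<in> D \<Longrightarrow> qm (sc c x) = (cmod c)\<^sup>2 * qm x"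
  by (simp_all add: qp_def qm_def integral_\<mu>_sc integrable_qp integrable_qm)

text \<open>The two integrands add up to |t - \<gamma>|, which is at least \<open>\<delta>\<close>
  off the gap.\<close>

lemma norm_le_qp_qm:
  assumes "x \<in> D"
  shows "\<delta> * (norm x)\<^sup>2 \<le> qp x + qm x"
proof -
  have "E (- {\<gamma> - \<delta><..<\<gamma> + \<delta>}) x = x" using gap by (simp add: E_Compl)
  then have "AE t in \<mu> x. t \<in> - {\<gamma> - \<delta><..<\<gamma> + \<delta>}" by (intro AE_\<mu>_mem) auto
  then have ae: "AE t in \<mu> x. \<delta> \<le> max 0 (t - \<gamma>) + max 0 (\<gamma> - t)" by eventually_elim auto
  have "(\<integral>t. \<delta> \<partial>\<mu> x) \<le> (\<integral>t. max 0 (t - \<gamma>) + max 0 (\<gamma> - t) \<partial>\<mu> x)"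
    using integrable_qp integrable_qm assms ae by (intro integral_mono_AE) auto
  also have "\<dots> = qp x + qm x"
    unfolding qp_def qm_def using integrable_qp integrable_qm assms
    by (intro Bochner_Integration.integral_add) auto
  finally show ?thesis by (simp add: mult.commute)
qed

lemma E_D: "S \<in> sets borel \<Longrightarrow> x \<in> D \<Longrightarrow> E S x \<in> D"
  unfolding form_dom_def by (simp add: integrable_\<mu>_E)

lemma qp_E_le: assumes "x \<in> D" "E {..\<gamma>} x = x" shows "qp x = 0"
proof -
  have "AE t in \<mu> x. t \<in> {..\<gamma>}" by (rule AE_\<mu>_mem) (use assms in auto)
  then have "AE t in \<mu> x. max 0 (t - \<gamma>) = 0" by eventually_elim auto
  then show ?thesis unfolding qp_def by (rule integral_eq_zero_AE)
qed

lemma qm_E_gt: assumes "x \<in> D" "E {\<gamma><..} x = x" shows "qm x = 0"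
proof -
  have "AE t in \<mu> x. t \<in> {\<gamma><..}" by (rule AE_\<mu>_mem) (use assms in auto)
  then have "AE t in \<mu> x. max 0 (\<gamma> - t) = 0" by eventually_elim auto
  then show ?thesis unfolding qm_def by (rule integral_eq_zero_AE)
qed

lemma E_decomp: "E {\<gamma><..} x + E {..\<gamma>} x = x"
  using E_Compl[of "{\<gamma><..}" x] by simp

lemma qp_E: assumes "x \<in> D" shows "qp (E {\<gamma><..} x) = qp x"
proof -
  have "(\<integral>t. max 0 (t - \<gamma>) \<partial>\<mu> (E {\<gamma><..} x + E {..\<gamma>} x)) =
    (\<integral>t. max 0 (t - \<gamma>) \<partial>\<mu> (E {\<gamma><..} x)) + (\<integral>t. max 0 (t - \<gamma>) \<partial>\<mu> (E {..\<gamma>} x))"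
    using assms by (intro integral_\<mu>_split[of _ _ _ "{\<gamma><..}"])
      (auto intro!: integrable_qp E_D simp: E_idem)
  then have "qp x = qp (E {\<gamma><..} x) + qp (E {..\<gamma>} x)" unfolding qp_def E_decomp .
  moreover have "qp (E {..\<gamma>} x) = 0" using assms by (intro qp_E_le) (auto simp: E_idem E_D)
  ultimately show ?thesis by simp
qed

lemma qm_E: assumes "x \<in> D" shows "qm (E {..\<gamma>} x) = qm x"
proof -
  have "(\<integral>t. max 0 (\<gamma> - t) \<partial>\<mu> (E {\<gamma><..} x + E {..\<gamma>} x)) =
    (\<integral>t. max 0 (\<gamma> - t) \<partial>\<mu> (E {\<gamma><..} x)) + (\<integral>t. max 0 (\<gamma> - t) \<partial>\<mu> (E {..\<gamma>} x))"
    using assms by (intro integral_\<mu>_split[of _ _ _ "{\<gamma><..}"])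
      (auto intro!: integrable_qm E_D simp: E_idem)
  then have "qm x = qm (E {\<gamma><..} x) + qm (E {..\<gamma>} x)" unfolding qm_def E_decomp .
  moreover have "qm (E {\<gamma><..} x) = 0" using assms by (intro qm_E_gt) (auto simp: E_idem E_D)
  ultimately show ?thesis by simp
qed

lemma nonneg_subspace_iff:
  "nonneg_subspace sc ip E \<gamma> M \<longleftrightarrow> cv.subspace M \<and> M \<subseteq> D \<and> (\<forall>x\<in>M. qm x \<le> qp x)"
proof -
  have "form_q ip E x - \<gamma> * (norm x)\<^sup>2 \<ge> 0 \<longleftrightarrow> qm x \<le> qp x" if "x \<in> D" for x
    using form_q_eq[OF that] by linarith
  then show ?thesis unfolding nonneg_subspace_def csubspace_def by blast
qed

text \<open>Maximality in usable form: the last hypothesis says that the span of \<open>M\<close>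
  and \<open>v\<close> is still non-negative.\<close>

lemma Mplus_absorb:
  assumes M: "M \<in> Mplus sc ip E \<gamma>" and v: "v \<in> D"
    and le: "\<And>m c. m \<in> M \<Longrightarrow> qm (m + sc c v) \<le> qp (m + sc c v)"
  shows "v \<in> M"
proof -
  have sub: "cv.subspace M" "M \<subseteq> D" using M by (auto simp: Mplus_def nonneg_subspace_iff)
  have spM: "cv.span M = M" using sub(1) by (rule cv.span_eq_iff[THEN iffD2])
  let ?M = "cv.span (insert v M)"
  have "nonneg_subspace sc ip E \<gamma> ?M"
    unfolding nonneg_subspace_iff
  proof (intro conjI ballI)
    show "?M \<subseteq> D" using sub v csubspace_D by (intro cv.span_minimal) auto
    fix x assume "x \<in> ?M"
    then obtain c where "x - sc c v \<in> M" unfolding cv.span_breakdown_eq spM by blast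
    from le[OF this, of c] show "qm x \<le> qp x" by simp
  qed simp
  moreover have "M \<subseteq> ?M" using cv.span_superset[of "insert v M"] by blast
  ultimately have "?M = M" using M unfolding Mplus_def by blast
  then show ?thesis using cv.span_base[of v "insert v M"] by auto
qed

text \<open>Since \<open>qm\<close> is at most \<open>qp\<close> on \<open>M\<close>, the gap turns
  a Cauchy sequence for \<open>qp\<close> into one for the norm. Lower semicontinuity places its
  norm limit in \<open>D\<close> and makes it a limit for \<open>qp\<close> and \<open>qm\<close>
  too; maximality puts it in \<open>M\<close>.\<close>

lemma Mplus_complete:
  assumes M: "M \<in> Mplus sc ip E \<gamma>" and u: "\<And>k. u k \<in> M"
    and cau: "\<And>e. e > 0 \<Longrightarrow> \<exists>K. \<forall>k\<ge>K. \<forall>l\<ge>K. qp (u k - u l) < e"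
  shows "\<exists>m\<in>M. (\<lambda>k. qp (u k - m)) \<longlonglongrightarrow> 0"
proof -
  have sub: "cv.subspace M" "M \<subseteq> D" and le: "\<And>x. x \<in> M \<Longrightarrow> qm x \<le> qp x"
    using M by (auto simp: Mplus_def nonneg_subspace_iff)
  have uD: "u k \<in> D" for k using u sub by auto
  have ul: "u k - u l \<in> M" for k l using u sub by (simp add: cv.subspace_diff)
  have "Cauchy u"
  proof (rule CauchyI)
    fix e :: real assume e: "0 < e"
    \<comment> \<open>On \<open>M\<close> the sum of \<open>qp\<close> and \<open>qm\<close> is at
      most twice \<open>qp\<close>, whence the division by 2.\<close>
    then obtain K where K: "\<And>k l. k \<ge> K \<Longrightarrow> l \<ge> K \<Longrightarrow> qp (u k - u l) < \<delta> * e\<^sup>2 / 2"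
      using cau[of "\<delta> * e\<^sup>2 / 2"] \<delta> by auto
    have "norm (u k - u l) < e" if "k \<ge> K" "l \<ge> K" for k l
    proof -
      have "\<delta> * (norm (u k - u l))\<^sup>2 < \<delta> * e\<^sup>2"
        using norm_le_qp_qm[of "u k - u l"] le[OF ul[of k l]] K[OF that] uD by simp
      then have "(norm (u k - u l))\<^sup>2 < e\<^sup>2" using \<delta> by simp
      then show ?thesis using e by (simp add: power2_less_imp_less)
    qed
    then show "\<exists>K. \<forall>k\<ge>K. \<forall>l\<ge>K. norm (u k - u l) < e" by blast
  qed
  then obtain m where m: "u \<longlonglongrightarrow> m" using convergent_def Cauchy_convergent by blast
  \<comment> \<open>The bound on \<open>u k - u l\<close> is kept while \<open>l\<close> tends to
    infinity with \<open>k\<close> fixed, so it holds for \<open>u k - m\<close>.\<close>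
  have lsc: "integrable (\<mu> (u k - m)) (\<lambda>t. max 0 (t - \<gamma>))" "integrable (\<mu> (u k - m)) (\<lambda>t. max 0 (\<gamma> - t))"
      "qp (u k - m) \<le> e" "qm (u k - m) \<le> e"
    if K: "\<And>k l. k \<ge> K \<Longrightarrow> l \<ge> K \<Longrightarrow> qp (u k - u l) < e" "k \<ge> K" for K k e
  proof -
    have lim: "(\<lambda>l. u k - u l) \<longlonglongrightarrow> u k - m" using m by (intro tendsto_intros)
    have 1: "integrable (\<mu> (u k - u l)) (\<lambda>t. max 0 (t - \<gamma>)) \<and> (\<integral>t. max 0 (t - \<gamma>) \<partial>\<mu> (u k - u l)) \<le> e"
      if "l \<ge> K" for l
      using K(1)[OF K(2) that] integrable_qp[of "u k - u l"] uD by (simp add: qp_def)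
    have 2: "integrable (\<mu> (u k - u l)) (\<lambda>t. max 0 (\<gamma> - t)) \<and> (\<integral>t. max 0 (\<gamma> - t) \<partial>\<mu> (u k - u l)) \<le> e"
      if "l \<ge> K" for l
      using K(1)[OF K(2) that] le[OF ul[of k l]] integrable_qm[of "u k - u l"] uD by (simp add: qm_def)
    show "integrable (\<mu> (u k - m)) (\<lambda>t. max 0 (t - \<gamma>))" "qp (u k - m) \<le> e"
      unfolding qp_def by (rule integral_\<mu>_lsc[OF _ _ lim 1]; simp)+
    show "integrable (\<mu> (u k - m)) (\<lambda>t. max 0 (\<gamma> - t))" "qm (u k - m) \<le> e"
      unfolding qm_def by (rule integral_\<mu>_lsc[OF _ _ lim 2]; simp)+
  qed
  have mD: "m \<in> D"
  proof -
    obtain K where "\<And>k l. k \<ge> K \<Longrightarrow> l \<ge> K \<Longrightarrow> qp (u k - u l) < 1" using cau[of 1] by auto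
    from lsc(1,2)[OF this, of K] have "u K - m \<in> D" by (intro D_I) auto
    then have "u K - (u K - m) \<in> D" by (rule qp.mem_diff[OF uD])
    then show ?thesis by simp
  qed
  have lim0: "(\<lambda>k. qp (u k - m)) \<longlonglongrightarrow> 0" "(\<lambda>k. qm (u k - m)) \<longlonglongrightarrow> 0"
  proof -
    have *: "\<exists>K. \<forall>k\<ge>K. qp (u k - m) < e \<and> qm (u k - m) < e" if "e > 0" for e
    proof -
      obtain K where K: "\<And>k l. k \<ge> K \<Longrightarrow> l \<ge> K \<Longrightarrow> qp (u k - u l) < e / 2" using cau[of "e / 2"] \<open>e > 0\<close> by auto
      show ?thesis using lsc(3,4)[OF K] \<open>e > 0\<close> by (intro exI[of _ K]) fastforce
    qed
    have "0 \<le> qp (u k - m)" "0 \<le> qm (u k - m)" for k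
      using qp.nonneg qm.nonneg uD mD by auto
    then show "(\<lambda>k. qp (u k - m)) \<longlonglongrightarrow> 0" "(\<lambda>k. qm (u k - m)) \<longlonglongrightarrow> 0"
      using * unfolding LIMSEQ_def dist_real_def by fastforce+
  qed
  have "m \<in> M"
  proof (rule Mplus_absorb[OF M mD])
    fix m' c assume m': "m' \<in> M"
    define x where "x = m' + sc c m"
    define y where "y k = m' + sc c (u k)" for k
    have yM: "y k \<in> M" for k unfolding y_def using m' u sub by (simp add: cv.subspace_add cv.subspace_scale)
    have xD: "x \<in> D" unfolding x_def using m' mD sub csubspace_D
      by (auto intro!: cv.subspace_add cv.subspace_scale)
    have yD: "y k \<in> D" for k using yM sub by auto
    have yx: "y k - x = sc c (u k - m)" for k by (simp add: x_def y_def cv.scale_right_diff_distrib)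
    \<comment> \<open>The vectors \<open>y k\<close> lie in \<open>M\<close> and approach
      \<open>x\<close> in both seminorms, so the inequality between \<open>qm\<close> and
      \<open>qp\<close> survives in the limit.\<close>
    have "sqrt (qm x) \<le> sqrt (qp x) + cmod c * sqrt (qp (u k - m)) + cmod c * sqrt (qm (u k - m))" for k
    proof -
      have "sqrt (qm x) \<le> sqrt (qm (y k)) + sqrt (qm (y k - x))"
        using qm.sqrt_diff[OF yD[of k] xD] by linarith
      also have "sqrt (qm (y k)) \<le> sqrt (qp (y k))" using le[OF yM] by simp
      also have "sqrt (qp (y k)) \<le> sqrt (qp x) + sqrt (qp (y k - x))"
        using qp.sqrt_diff[OF yD[of k] xD] by linarith
      finally show ?thesis unfolding yx using uD mD
        by (simp add: qp_sc qm_sc real_sqrt_mult)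
    qed
    moreover have "(\<lambda>k. sqrt (qp x) + cmod c * sqrt (qp (u k - m)) + cmod c * sqrt (qm (u k - m)))
        \<longlonglongrightarrow> sqrt (qp x) + cmod c * sqrt 0 + cmod c * sqrt 0"
      using lim0 by (intro tendsto_intros)
    ultimately have "sqrt (qm x) \<le> sqrt (qp x) + cmod c * sqrt 0 + cmod c * sqrt 0"
      by (intro LIMSEQ_le_const) auto
    then show "qm (m' + sc c m) \<le> qp (m' + sc c m)" by (simp add: x_def)
  qed
  with lim0 show ?thesis by blast
qed

text \<open>With respect to the form shifted by \<open>\<gamma>\<close>, the domain \<open>D\<close> is a Krein space and a maximal
  non-negative subspace is the graph of a contraction defined on all of the positive part: were
  \<open>w\<close> not in the projection of \<open>M\<close>, its component orthogonal to that projection could be added to \<open>M\<close>.\<close>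

lemma Mplus_projection_surj:
  assumes M: "M \<in> Mplus sc ip E \<gamma>" and w: "w \<in> D" "E {\<gamma><..} w = w"
  obtains m where "m \<in> M" "E {\<gamma><..} m = w"
proof -
  let ?P = "E {\<gamma><..}"
  have sub: "cv.subspace M" "M \<subseteq> D" and le: "\<And>x. x \<in> M \<Longrightarrow> qm x \<le> qp x"
    using M by (auto simp: Mplus_def nonneg_subspace_iff)
  obtain m where m: "m \<in> M" "\<And>m'. m' \<in> M \<Longrightarrow> qp (w - m + m') = qp (w - m) + qp m'"
    using qp.orthogonal_projection[OF csubspace_real[OF sub(1)] sub(2) w(1) Mplus_complete[OF M]] by blast
  have mD: "m \<in> D" using m sub by auto
  define v where "v = w - ?P m"
  have v_eq: "v = ?P (w - m)" by (simp add: v_def E_diff w)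
  have Pv: "?P v = v" by (simp add: v_eq E_idem)
  have Qv: "E {..\<gamma>} v = 0" using E_decomp[of v] Pv by simp
  have vD: "v \<in> D" using w mD by (simp add: v_def E_D)
  \<comment> \<open>Since \<open>qp\<close> only sees the component in the range of
    \<open>?P\<close>, the orthogonality of \<open>w - m\<close> to \<open>M\<close> is inherited by
    its projection \<open>v\<close>.\<close>
  have add: "qp (v + m') = qp v + qp m'" if m': "m' \<in> M" for m'
  proof -
    have D': "m' \<in> D" using m' sub by auto
    have "qp (v + m') = qp (?P (v + m'))" using vD D' by (simp add: qp_E)
    also have "?P (v + m') = ?P (w - m + m')" by (simp add: E_add Pv v_eq E_idem)
    also have "qp \<dots> = qp (w - m + m')" using w mD D' by (intro qp_E) auto
    also have "\<dots> = qp v + qp m'" using m(2)[OF m'] w mD by (simp add: v_eq qp_E)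
    finally show ?thesis .
  qed
  have vM: "v \<in> M"
  proof (rule Mplus_absorb[OF M vD])
    fix m' c assume m': "m' \<in> M"
    have D': "m' \<in> D" using m' sub by auto
    have cD: "sc c v \<in> D" using vD csubspace_D by (simp add: cv.subspace_scale)
    have "qm (m' + sc c v) = qm (E {..\<gamma>} (m' + sc c v))" using D' cD by (simp add: qm_E)
    also have "E {..\<gamma>} (m' + sc c v) = E {..\<gamma>} m'" by (simp add: E_add E_sc Qv)
    also have "qm \<dots> = qm m'" using D' by (rule qm_E)
    also have "\<dots> \<le> qp m'" by (rule le[OF m'])
    also have "\<dots> \<le> qp (m' + sc c v)"
    proof (cases "c = 0")
      case False
      have "sc (inverse c) m' \<in> M" using m' sub by (simp add: cv.subspace_scale)
      then have "qp (v + sc (inverse c) m') = qp v + (cmod (inverse c))\<^sup>2 * qp m'"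
        using add D' by (simp add: qp_sc)
      moreover have "m' + sc c v = sc c (v + sc (inverse c) m')"
        using False by (simp add: cv.scale_right_distrib add.commute)
      moreover have "v + sc (inverse c) m' \<in> D"
        using vD D' csubspace_D by (intro cv.subspace_add cv.subspace_scale)
      ultimately have "qp (m' + sc c v) = (cmod c)\<^sup>2 * (qp v + (cmod (inverse c))\<^sup>2 * qp m')"
        by (simp add: qp_sc)
      also have "\<dots> = (cmod c)\<^sup>2 * qp v + qp m'"
        using False by (simp add: norm_inverse algebra_simps power_mult_distrib[symmetric])
      finally show ?thesis using qp.nonneg[OF vD] by simp
    qed simp
    finally show "qm (m' + sc c v) \<le> qp (m' + sc c v)" .
  qed
  \<comment> \<open>Once \<open>v\<close> is in \<open>M\<close>, Pythagoras applies to
    \<open>- v\<close> and gives 0 = 2 \<open>qp v\<close>; as \<open>qm v\<close> vanishes too, the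
    gap forces \<open>v = 0\<close>.\<close>
  have "- v \<in> M" using vM sub by (simp add: cv.subspace_neg)
  from add[OF this] have "qp v = 0" using vD by (simp add: qp.q_minus)
  moreover have "qm v = 0" using vD Pv by (rule qm_E_gt)
  ultimately have "\<delta> * (norm v)\<^sup>2 \<le> 0" using norm_le_qp_qm[OF vD] by simp
  then have "v = 0" using \<delta> by (simp add: mult_le_0_iff)
  then have "?P m = w" by (simp add: v_def)
  with m(1) show ?thesis by (rule that)
qed

end

section \<open>Spectrum and spectral measure\<close>

context spectral_resolution
begin

lemma csubspace_DA: "cv.subspace DA"
  and dense_DA: "closure DA = UNIV"
  and A_add: "x \<in> DA \<Longrightarrow> y \<in> DA \<Longrightarrow> A (x + y) = A x + A y"
  and A_sc: "x \<in> DA \<Longrightarrow> A (sc c x) = sc c (A x)"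
  and A_sym: "x \<in> DA \<Longrightarrow> y \<in> DA \<Longrightarrow> ip (A x) y = ip x (A y)"
  and adjoint_dom: "{y. \<exists>z. \<forall>x\<in>DA. ip (A x) y = ip x z} = DA"
  using sa unfolding selfadjoint_def csubspace_def by blast+

lemma DA_eq: "DA = {x. integrable (\<mu> x) (\<lambda>t. t\<^sup>2)}"
  and ip_A_self: "x \<in> DA \<Longrightarrow> ip (A x) x = complex_of_real (\<integral>t. t \<partial>\<mu> x)"
  using spec unfolding spectral_measure_of_def by blast+

lemma A_scaleR: "x \<in> DA \<Longrightarrow> A (r *\<^sub>R x) = r *\<^sub>R A x"
  using A_sc[of x "complex_of_real r"] by simp

lemma DA_add: "x \<in> DA \<Longrightarrow> y \<in> DA \<Longrightarrow> x + y \<in> DA"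
  and DA_diff: "x \<in> DA \<Longrightarrow> y \<in> DA \<Longrightarrow> x - y \<in> DA"
  and DA_sc: "x \<in> DA \<Longrightarrow> sc c x \<in> DA"
  and DA_0: "0 \<in> DA"
  using csubspace_DA by (simp_all add: cv.subspace_add cv.subspace_diff cv.subspace_scale cv.subspace_0)

lemma DA_scaleR: "x \<in> DA \<Longrightarrow> r *\<^sub>R x \<in> DA"
  using DA_sc[of x "complex_of_real r"] by simp

lemma A_diff: "x \<in> DA \<Longrightarrow> y \<in> DA \<Longrightarrow> A (x - y) = A x - A y"
  using A_add[of x "(-1) *\<^sub>R y"] A_scaleR[of y "-1"] DA_scaleR[of y "-1"] by simp

lemma DA_integrable: "x \<in> DA \<Longrightarrow> integrable (\<mu> x) (\<lambda>t. t)"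
proof -
  assume "x \<in> DA"
  then have "integrable (\<mu> x) (\<lambda>t. 1 + t\<^sup>2)" by (simp add: DA_eq)
  then show ?thesis
  proof (rule Bochner_Integration.integrable_bound)
    have "\<bar>t\<bar> \<le> 1 + t\<^sup>2" for t :: real
    proof -
      have "0 \<le> (\<bar>t\<bar> - 1)\<^sup>2" by simp
      then have "2 * \<bar>t\<bar> \<le> 1 + t\<^sup>2" by (simp add: power2_diff)
      then show ?thesis by linarith
    qed
    then show "AE t in \<mu> x. norm t \<le> norm (1 + t\<^sup>2)" by simp
  qed simp
qed

lemma DA_bounded:
  assumes "S \<in> sets borel" "E S x = x" "\<And>t. t \<in> S \<Longrightarrow> \<bar>t\<bar> \<le> k"
  shows "x \<in> DA"
proof -
  have "AE t in \<mu> x. t \<in> S" using assms by (intro AE_\<mu>_mem)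
  then have "AE t in \<mu> x. norm (t\<^sup>2) \<le> k\<^sup>2"
  proof eventually_elim
    case (elim t)
    have "\<bar>t\<bar>\<^sup>2 \<le> k\<^sup>2" by (rule power_mono) (use assms(3)[OF elim] in auto)
    then show ?case by simp
  qed
  then have "integrable (\<mu> x) (\<lambda>t. t\<^sup>2)"
    by (rule finite_measure.integrable_const_bound[OF finite_measure_\<mu>]) simp
  then show ?thesis by (simp add: DA_eq)
qed

lemma DA_E: "S \<in> sets borel \<Longrightarrow> x \<in> DA \<Longrightarrow> E S x \<in> DA"
  by (simp add: DA_eq integrable_\<mu>_E)

lemma integral_ge:
  assumes "integrable (\<mu> x) (\<lambda>t. t)" "S \<in> sets borel" "E S x = x" "\<And>t. t \<in> S \<Longrightarrow> a \<le> t"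
  shows "a * (norm x)\<^sup>2 \<le> (\<integral>t. t \<partial>\<mu> x)"
proof -
  have "AE t in \<mu> x. t \<in> S" using assms by (intro AE_\<mu>_mem)
  then have "AE t in \<mu> x. a \<le> t" by eventually_elim (use assms(4) in auto)
  then show ?thesis
    unfolding integral_const_\<mu>[symmetric] using assms(1) by (intro integral_mono_AE) auto
qed

lemma integral_le:
  assumes "integrable (\<mu> x) (\<lambda>t. t)" "S \<in> sets borel" "E S x = x" "\<And>t. t \<in> S \<Longrightarrow> t \<le> a"
  shows "(\<integral>t. t \<partial>\<mu> x) \<le> a * (norm x)\<^sup>2"
proof -
  have "AE t in \<mu> x. t \<in> S" using assms by (intro AE_\<mu>_mem)
  then have "AE t in \<mu> x. t \<le> a" by eventually_elim (use assms(4) in auto)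
  then show ?thesis
    unfolding integral_const_\<mu>[symmetric] using assms(1) by (intro integral_mono_AE) auto
qed

lemma Re_ip_shift: "x \<in> DA \<Longrightarrow> Re (ip (A x - c *\<^sub>R x) x) = (\<integral>t. t \<partial>\<mu> x) - c * (norm x)\<^sup>2"
  by (simp add: ip_simps ip_A_self ip_self)

text \<open>Polarisation of the diagonal identity: the integrals at \<open>x\<close>,
  \<open>y\<close> and \<open>x + y\<close> are additive, so the cross terms cancel. This gives the
  real part, and i times \<open>y\<close> gives the imaginary part.\<close>

lemma ip_A_orthogonal:
  assumes S: "S \<in> sets borel" and x: "x \<in> DA" "E S x = x" and y: "y \<in> DA" "E (- S) y = y"
  shows "ip (A x) y = 0"
proof -
  have Re0: "Re (ip (A x) y) = 0" if y: "y \<in> DA" "E (- S) y = y" for y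
  proof -
    have "ip (A (x + y)) (x + y) = ip (A x) x + ip (A y) y"
      using integral_\<mu>_split[OF DA_integrable[OF x(1)] DA_integrable[OF y(1)] S x(2) y(2)]
      by (simp add: ip_A_self x y DA_add)
    moreover have "ip (A (x + y)) (x + y) = ip (A x) x + ip (A y) y + ip (A x) y + ip (A y) x"
      using x y by (simp add: A_add ip_simps)
    moreover have "ip (A y) x = cnj (ip (A x) y)"
      using A_sym[OF y(1) x(1)] ip_cnj[of y "A x"] by simp
    ultimately have "ip (A x) y + cnj (ip (A x) y) = 0" by simp
    then show ?thesis by (simp add: complex_eq_iff)
  qed
  have "- S \<in> sets borel" using S by auto
  then have "Re (ip (A x) (sc \<i> y)) = 0" using y by (intro Re0) (auto simp: DA_sc E_sc)
  then have "Im (ip (A x) y) = 0" by (simp add: ip_sc_right)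
  with Re0[OF y] show ?thesis by (simp add: complex_eq_iff)
qed

text \<open>Tested against the dense set \<open>DA\<close>, the preceding orthogonality shows that
  \<open>A\<close> sends domain vectors fixed by \<open>E (- T)\<close> into the kernel of
  \<open>E T\<close>. Using this for \<open>S\<close> and for its complement gives
  commutation.\<close>

lemma E_A_commute:
  assumes S: "S \<in> sets borel" and x: "x \<in> DA"
  shows "E S (A x) = A (E S x)"
proof -
  have zero: "E T (A (E (- T) x)) = 0" if T: "T \<in> sets borel" for T
  proof (rule eq_if_ip_eq_dense[OF dense_DA])
    fix w assume w: "w \<in> DA"
    have T': "- T \<in> sets borel" using T by auto
    have "ip (A (E T w)) (E (- T) x) = 0"
      using T T' w x by (intro ip_A_orthogonal[OF T]) (auto simp: DA_E E_idem)
    then have "ip (E T w) (A (E (- T) x)) = 0" using A_sym[of "E T w" "E (- T) x"] T T' w x by (simp add: DA_E)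
    then show "ip w (E T (A (E (- T) x))) = ip w 0" using T by (simp add: E_sym)
  qed
  have S': "- S \<in> sets borel" using S by auto
  have "A x = A (E S x) + A (E (- S) x)"
    using A_add[OF DA_E[OF S x] DA_E[OF S' x]] E_Compl[OF S] by simp
  then have "E S (A x) = E S (A (E S x))" using zero[OF S] S by (simp add: E_add)
  also have "\<dots> = A (E S x)" using zero[OF S'] E_Compl[OF S] by simp
  finally show ?thesis .
qed

text \<open>The integrals bound only the quadratic form of the shifted operator \<open>B\<close>.
  That this bounds its norm is the fact that a symmetric operator has norm at most its numerical
  radius, proved here by testing with \<open>x\<close> plus and minus a multiple of
  \<open>z = B x\<close>.\<close>

lemma norm_shift_le:
  assumes S: "S \<in> sets borel" and x: "E S x = x" and d: "\<And>t. t \<in> S \<Longrightarrow> \<bar>t - c\<bar> \<le> d" "0 \<le> d"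
  shows "norm (A x - c *\<^sub>R x) \<le> d * norm x"
proof -
  have inDA: "w \<in> DA" if "E S w = w" for w
  proof (rule DA_bounded[OF S that])
    fix t assume "t \<in> S"
    then show "\<bar>t\<bar> \<le> \<bar>c\<bar> + d" using d(1)[of t] by linarith
  qed
  define B where "B w = A w - c *\<^sub>R w" for w
  have bound: "\<bar>Re (ip (B w) w)\<bar> \<le> d * (norm w)\<^sup>2" if w: "E S w = w" for w
  proof -
    have "(c - d) * (norm w)\<^sup>2 \<le> (\<integral>t. t \<partial>\<mu> w)" "(\<integral>t. t \<partial>\<mu> w) \<le> (c + d) * (norm w)\<^sup>2"
      by (rule integral_ge[OF DA_integrable[OF inDA[OF w]] S w], use d(1) in fastforce,
          rule integral_le[OF DA_integrable[OF inDA[OF w]] S w], use d(1) in fastforce)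
    then show ?thesis unfolding B_def Re_ip_shift[OF inDA[OF w]] by (simp add: algebra_simps abs_le_iff)
  qed
  define z where "z = B x"
  have z: "E S z = z"
    unfolding z_def B_def using S x by (simp add: E_diff E_scaleR E_A_commute inDA)
  have key: "4 * s * (norm z)\<^sup>2 \<le> 2 * d * ((norm x)\<^sup>2 + s\<^sup>2 * (norm z)\<^sup>2)" for s :: real
  proof -
    have zs: "s *\<^sub>R z \<in> DA" "E S (s *\<^sub>R z) = s *\<^sub>R z" using z S by (auto simp: E_scaleR inDA DA_scaleR)
    have B1: "B (x + s *\<^sub>R z) = B x + s *\<^sub>R B z" "B (x - s *\<^sub>R z) = B x - s *\<^sub>R B z"
      unfolding B_def using inDA[OF x] inDA[OF z] zs
      by (auto simp: A_add A_diff A_scaleR algebra_simps)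
    have "ip (B z) x = ip z (B x)"
      unfolding B_def using A_sym[OF inDA[OF z] inDA[OF x]] by (simp add: ip_simps)
    then have "Re (ip (B (x + s *\<^sub>R z)) (x + s *\<^sub>R z)) - Re (ip (B (x - s *\<^sub>R z)) (x - s *\<^sub>R z)) = 4 * s * (norm z)\<^sup>2"
      unfolding B1 by (simp add: ip_simps z_def[symmetric] ip_self algebra_simps)
    moreover have "\<bar>Re (ip (B (x + s *\<^sub>R z)) (x + s *\<^sub>R z))\<bar> \<le> d * (norm (x + s *\<^sub>R z))\<^sup>2"
      "\<bar>Re (ip (B (x - s *\<^sub>R z)) (x - s *\<^sub>R z))\<bar> \<le> d * (norm (x - s *\<^sub>R z))\<^sup>2"
      using zs x S by (auto intro!: bound simp: E_add E_diff)
    ultimately have "4 * s * (norm z)\<^sup>2 \<le> d * ((norm (x + s *\<^sub>R z))\<^sup>2 + (norm (x - s *\<^sub>R z))\<^sup>2)"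
      by (simp add: distrib_left)
    also have "(norm (x + s *\<^sub>R z))\<^sup>2 + (norm (x - s *\<^sub>R z))\<^sup>2 = 2 * ((norm x)\<^sup>2 + s\<^sup>2 * (norm z)\<^sup>2)"
      by (simp add: norm_add_sq norm_diff_sq power_mult_distrib)
    finally show ?thesis by (simp add: algebra_simps)
  qed
  show ?thesis
  proof (cases "z = 0 \<or> x = 0")
    case True
    moreover have "z = 0" if "x = 0" using that DA_0 A_scaleR[of 0 0] by (simp add: z_def B_def)
    ultimately show ?thesis using d(2) unfolding z_def B_def by auto
  next
    case False
    have "4 * (norm x * norm z) \<le> 4 * (d * (norm x * norm x))"
      \<comment> \<open>This \<open>s\<close> balances the two terms on the right of
        \<open>key\<close> and gives the sharp constant.\<close>
      using key[of "norm x / norm z"] False by (simp add: power2_eq_square field_simps)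
    then have "norm x * norm z \<le> norm x * (d * norm x)" by (simp add: ac_simps)
    then show ?thesis using False unfolding z_def B_def by simp
  qed
qed

text \<open>Split \<open>x\<close> at \<open>c\<close> into \<open>u\<close> above and
  \<open>v\<close> below, and test the shifted operator against \<open>u - v\<close>: the sign flip
  makes both halves contribute at least \<open>d\<close> times their squared norm, while
  \<open>u - v\<close> is as long as \<open>x\<close>.\<close>

lemma norm_shift_ge:
  assumes S: "S \<in> sets borel" and x: "x \<in> DA" "E S x = x" and d: "\<And>t. t \<in> S \<Longrightarrow> d \<le> \<bar>t - c\<bar>"
    and "0 < d"
  shows "d * norm x \<le> norm (A x - c *\<^sub>R x)"
proof (cases "x = 0")
  case False
  define u where "u = E {c..} x"
  define v where "v = E ({..<c}) x"
  have [simp]: "S \<inter> {c..} \<in> sets borel" "S \<inter> {..<c} \<in> sets borel" using S by auto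
  have "E {..<c} x = x - E {c..} x" using E_Compl[of "{c..}" x] by simp
  then have xuv: "x = u + v" by (simp only: u_def v_def) simp
  have uD: "u \<in> DA" and vD: "v \<in> DA" using x by (auto simp: u_def v_def DA_E)
  have "u = E (S \<inter> {c..}) x" using x(2) S unfolding u_def by (metis E_Int Int_commute atLeast_borel)
  then have Eu: "E (S \<inter> {c..}) u = u" by (simp add: E_idem)
  have "v = E (S \<inter> {..<c}) x"
    using x(2) S E_Int[of "{..<c}" S x] by (simp add: v_def Int_commute)
  then have Ev: "E (S \<inter> {..<c}) v = v" by (simp add: E_idem)
  have "(c + d) * (norm u)\<^sup>2 \<le> (\<integral>t. t \<partial>\<mu> u)"
    by (rule integral_ge[OF DA_integrable[OF uD] _ Eu]) (use d in fastforce)+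
  then have bu: "d * (norm u)\<^sup>2 \<le> Re (ip (A u - c *\<^sub>R u) u)"
    unfolding Re_ip_shift[OF uD] by (simp add: algebra_simps)
  have "(\<integral>t. t \<partial>\<mu> v) \<le> (c - d) * (norm v)\<^sup>2"
    by (rule integral_le[OF DA_integrable[OF vD] _ Ev]) (use d in fastforce)+
  then have bv: "Re (ip (A v - c *\<^sub>R v) v) \<le> - d * (norm v)\<^sup>2"
    unfolding Re_ip_shift[OF vD] by (simp add: algebra_simps)
  have uv: "ip u v = 0" "ip v u = 0" unfolding u_def v_def by (auto intro!: E_orthogonal)
  have Auv: "ip (A u) v = 0" "ip (A v) u = 0"
    using ip_A_orthogonal[of "{c..}" u v] uD vD A_sym[OF vD uD] ip_eq_0_sym[of "A u" v]
    by (auto simp: u_def v_def E_idem)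
  have "Re (ip (A x - c *\<^sub>R x) (u - v)) = Re (ip (A u - c *\<^sub>R u) u) - Re (ip (A v - c *\<^sub>R v) v)"
    unfolding xuv using uD vD uv Auv by (simp add: A_add ip_simps scaleR_add_right)
  then have "d * ((norm u)\<^sup>2 + (norm v)\<^sup>2) \<le> Re (ip (A x - c *\<^sub>R x) (u - v))"
    using bu bv by (simp add: distrib_left)
  also have "\<dots> \<le> norm (A x - c *\<^sub>R x) * norm (u - v)" by (rule Re_ip_le)
  also have "norm (u - v) = norm x"
  proof -
    have "(norm (u - v))\<^sup>2 = (norm x)\<^sup>2" unfolding xuv norm_add_sq norm_diff_sq using uv by simp
    then show ?thesis by (simp add: power2_eq_iff_nonneg)
  qed
  also have "(norm u)\<^sup>2 + (norm v)\<^sup>2 = norm x * norm x"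
    unfolding xuv power2_eq_square[symmetric] norm_add_sq using uv by simp
  finally show ?thesis using False by simp
qed simp

text \<open>The bound for \<open>z\<close> gives injectivity and closed range. A vector orthogonal
  to the range would be an eigenvector for \<open>cnj z\<close>, which the second bound excludes, so
  the range is everything.\<close>

lemma resolvent_set_I:
  assumes k: "k > 0" and lower: "\<And>x. x \<in> DA \<Longrightarrow> k * norm x \<le> norm (A x - sc z x)"
    and lower': "\<And>x. x \<in> DA \<Longrightarrow> k * norm x \<le> norm (A x - sc (cnj z) x)"
  shows "z \<in> resolvent_set sc A DA"
proof -
  let ?T = "\<lambda>x. A x - sc z x"
  have T_diff: "?T (x - y) = ?T x - ?T y" if "x \<in> DA" "y \<in> DA" for x y
    using that by (simp add: A_diff cv.scale_right_diff_distrib)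
  have inj: "inj_on ?T DA"
  proof (rule inj_onI)
    fix x y assume xy: "x \<in> DA" "y \<in> DA" "?T x = ?T y"
    then have "k * norm (x - y) \<le> 0" using lower[of "x - y"] T_diff[of x y] DA_diff by simp
    then show "x = y" using k by (simp add: mult_le_0_iff)
  qed
  let ?R = "?T ` DA"
  have R1: "cv.subspace ?R"
    unfolding cv.subspace_def
  proof (intro conjI ballI allI)
    have "?T 0 = 0" using A_diff[OF DA_0 DA_0] by simp
    then show "0 \<in> ?R" using image_eqI[of 0 ?T 0 DA] DA_0 by simp
    fix a b c assume "a \<in> ?R" "b \<in> ?R"
    then obtain x y where xy: "x \<in> DA" "y \<in> DA" "a = ?T x" "b = ?T y" by auto
    have "a + b = ?T (x + y)" using xy by (simp add: A_add cv.scale_right_distrib)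
    then show "a + b \<in> ?R" using xy DA_add by blast
  next
    fix a c assume "a \<in> ?R"
    then obtain x where x: "x \<in> DA" "a = ?T x" by auto
    have "sc c a = ?T (sc c x)"
      using x by (simp add: A_sc cv.scale_right_diff_distrib mult.commute)
    then show "sc c a \<in> ?R" using x DA_sc by blast
  qed
  have R2: "closed ?R"
    unfolding closed_sequential_limits
  proof (intro allI impI, elim conjE)
    fix f y assume f: "\<forall>n. f n \<in> ?R" and lim: "f \<longlonglongrightarrow> y"
    then obtain x where x: "\<And>n. x n \<in> DA" "\<And>n. f n = ?T (x n)"
      unfolding image_iff by metis
    have "Cauchy x"
    proof (rule CauchyI)
      fix e :: real assume "0 < e"
      then obtain K where K: "\<And>m n. m \<ge> K \<Longrightarrow> n \<ge> K \<Longrightarrow> norm (f m - f n) < k * e"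
        using LIMSEQ_imp_Cauchy[OF lim] k CauchyD[of f "k * e"] by auto
      have "norm (x m - x n) < e" if "m \<ge> K" "n \<ge> K" for m n
      proof -
        have "k * norm (x m - x n) \<le> norm (f m - f n)"
          using lower[of "x m - x n"] x T_diff DA_diff by simp
        also have "\<dots> < k * e" using K that by simp
        finally show ?thesis using k by simp
      qed
      then show "\<exists>K. \<forall>m\<ge>K. \<forall>n\<ge>K. norm (x m - x n) < e" by blast
    qed
    then obtain l where l: "x \<longlonglongrightarrow> l" using convergent_def Cauchy_convergent by blast
    have scR: "sc z (r *\<^sub>R x) = r *\<^sub>R sc z x" for r x
      using cv.scale_left_commute[of z "complex_of_real r" x] by (simp only: sc_of_real)
    have bl: "bounded_linear (sc z)"
      by (rule bounded_linear_intro[where K="cmod z"])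
        (auto simp: cv.scale_right_distrib norm_sc mult.commute scR)
    have Ax: "(\<lambda>n. A (x n)) \<longlonglongrightarrow> y + sc z l"
    proof -
      have "(\<lambda>n. f n + sc z (x n)) \<longlonglongrightarrow> y + sc z l"
        using lim bounded_linear.tendsto[OF bl l] by (intro tendsto_intros)
      then show ?thesis by (simp add: x(2))
    qed
    \<comment> \<open>This is the closedness of \<open>A\<close>: symmetry passes to the limit, so
      \<open>l\<close> lies in the domain of the adjoint, which is \<open>DA\<close>.\<close>
    have adj: "ip (A w) l = ip w (y + sc z l)" if w: "w \<in> DA" for w
    proof (rule LIMSEQ_unique)
      show "(\<lambda>n. ip (A w) (x n)) \<longlonglongrightarrow> ip (A w) l" using l by (rule tendsto_ip_right)
      show "(\<lambda>n. ip (A w) (x n)) \<longlonglongrightarrow> ip w (y + sc z l)"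
        using tendsto_ip_right[OF Ax, of w] A_sym[OF w x(1)] by simp
    qed
    then have lD: "l \<in> DA" using adjoint_dom by blast
    have "A l = y + sc z l"
      using adj A_sym[OF _ lD] by (intro eq_if_ip_eq_dense[OF dense_DA]) auto
    then have "y = ?T l" by simp
    then show "y \<in> ?R" using lD by blast
  qed
  have "?R = UNIV"
  proof (rule ccontr)
    assume "?R \<noteq> UNIV"
    then obtain w where "w \<notin> ?R" by blast
    from orthogonal_vector_exists[OF R1 R2 this]
    obtain v where v: "v \<noteq> 0" "\<And>x. x \<in> ?R \<Longrightarrow> ip x v = 0" by blast
    have adj: "ip (A x) v = ip x (sc (cnj z) v)" if "x \<in> DA" for x
      using v(2)[of "?T x"] that by (auto simp: ip_simps)
    then have vD: "v \<in> DA" using adjoint_dom by blast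
    have "A v = sc (cnj z) v"
      using adj A_sym[OF _ vD] by (intro eq_if_ip_eq_dense[OF dense_DA]) auto
    then have "k * norm v \<le> 0" using lower'[OF vD] by simp
    then show False using v(1) k by (simp add: mult_le_0_iff)
  qed
  then have "bij_betw ?T DA UNIV" using inj by (simp add: bij_betw_def)
  moreover have "\<exists>C. \<forall>x\<in>DA. norm x \<le> C * norm (?T x)"
    using lower k by (intro exI[of _ "1 / k"]) (auto simp: field_simps)
  ultimately show ?thesis unfolding resolvent_set_def by blast
qed

text \<open>As \<open>ip (A x) x\<close> is real, the imaginary part of the shifted form is
  \<open>- Im z\<close> times the squared norm, which yields the lower bound for both
  \<open>z\<close> and its conjugate.\<close>

lemma resolvent_set_nonreal:
  assumes "Im z \<noteq> 0"
  shows "z \<in> resolvent_set sc A DA"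
proof -
  have "\<bar>Im z\<bar> * norm x \<le> norm (A x - sc z x)" if "x \<in> DA" for x z
  proof (cases "x = 0")
    case False
    have "Im (ip (A x - sc z x) x) = - (Im z * (norm x)\<^sup>2)"
      using that by (simp add: ip_simps ip_A_self ip_self)
    then have "\<bar>Im z\<bar> * (norm x)\<^sup>2 \<le> cmod (ip (A x - sc z x) x)"
      using abs_Im_le_cmod[of "ip (A x - sc z x) x"] by (simp add: abs_mult)
    also have "\<dots> \<le> norm (A x - sc z x) * norm x" by (rule Cauchy_Schwarz)
    finally show ?thesis using False by (simp add: power2_eq_square)
  qed simp
  from this[of _ z] this[of _ "cnj z"] show ?thesis
    using assms by (intro resolvent_set_I[of "\<bar>Im z\<bar>"]) auto
qed

lemma resolvent_set_real_iff:
  "complex_of_real c \<in> resolvent_set sc A DA \<longleftrightarrow> (\<exists>d>0. \<forall>x. E {c - d<..<c + d} x = 0)"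
proof
  assume "complex_of_real c \<in> resolvent_set sc A DA"
  then obtain C where C: "\<And>x. x \<in> DA \<Longrightarrow> norm x \<le> C * norm (A x - c *\<^sub>R x)"
    by (auto simp: resolvent_set_def)
  \<comment> \<open>Chosen so that \<open>\<bar>C\<bar> * d\<close> is at most 1/2: a vector
    \<open>y\<close> in the spectral range of the interval then has \<open>norm y\<close> at most
    half of itself.\<close>
  define d where "d = 1 / (2 * (\<bar>C\<bar> + 1))"
  have d: "d > 0" "\<bar>C\<bar> * d \<le> 1 / 2" by (auto simp: d_def field_simps)
  have "E {c - d<..<c + d} x = 0" for x
  proof -
    define y where "y = E {c - d<..<c + d} x"
    have Ey: "E {c - d<..<c + d} y = y" by (simp add: y_def E_idem)
    have "y \<in> DA" by (rule DA_bounded[OF _ Ey, of "\<bar>c\<bar> + d"]) auto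
    then have "norm y \<le> C * norm (A y - c *\<^sub>R y)" by (rule C)
    also have "\<dots> \<le> \<bar>C\<bar> * norm (A y - c *\<^sub>R y)" by (intro mult_right_mono) auto
    also have "\<dots> \<le> \<bar>C\<bar> * (d * norm y)"
      using d by (intro mult_left_mono norm_shift_le[OF _ Ey]) auto
    also have "\<dots> \<le> 1 / 2 * norm y"
      unfolding mult.assoc[symmetric] using d by (intro mult_right_mono) auto
    finally show ?thesis by (simp add: y_def)
  qed
  with d show "\<exists>d>0. \<forall>x. E {c - d<..<c + d} x = 0" by blast
next
  assume "\<exists>d>0. \<forall>x. E {c - d<..<c + d} x = 0"
  then obtain d where d: "d > 0" "\<And>x. E {c - d<..<c + d} x = 0" by blast
  have "d * norm x \<le> norm (A x - c *\<^sub>R x)" if "x \<in> DA" for x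
    using d by (intro norm_shift_ge[of "- {c - d<..<c + d}"] that) (auto simp: E_Compl)
  then show "complex_of_real c \<in> resolvent_set sc A DA"
    using d by (intro resolvent_set_I[of d]) auto
qed

text \<open>For an eigenvector \<open>x\<close>, its part \<open>E (F n) x\<close> is again
  annihilated by the shifted operator, but that operator is bounded below at positive distance from
  \<open>t\<close>, so the part is zero. The sets \<open>F n\<close> exhaust the complement of
  \<open>t\<close>.\<close>

lemma eigenspace_eq: "eigenspace sc A DA (complex_of_real t) = {x. E {t} x = x}"
proof (intro subset_antisym subsetI)
  fix x assume "x \<in> {x. E {t} x = x}"
  then have x: "E {t} x = x" by simp
  have "x \<in> DA" by (rule DA_bounded[OF _ x, of "\<bar>t\<bar>"]) auto
  moreover have "norm (A x - t *\<^sub>R x) \<le> 0 * norm x" by (rule norm_shift_le[OF _ x]) auto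
  ultimately show "x \<in> eigenspace sc A DA (complex_of_real t)" by (simp add: eigenspace_def)
next
  fix x assume "x \<in> eigenspace sc A DA (complex_of_real t)"
  then have x: "x \<in> DA" "A x = t *\<^sub>R x" by (auto simp: eigenspace_def)
  define F where "F n = {s. inverse (real (Suc n)) \<le> \<bar>s - t\<bar>}" for n
  have F: "F n \<in> sets borel" for n unfolding F_def by measurable
  have "E (F n) x = 0" for n
  proof -
    have "inverse (real (Suc n)) * norm (E (F n) x) \<le> norm (A (E (F n) x) - t *\<^sub>R E (F n) x)"
      using F x by (intro norm_shift_ge[of "F n"]) (auto simp: DA_E E_idem F_def)
    also have "A (E (F n) x) = t *\<^sub>R E (F n) x"
      using E_A_commute[OF F x(1)] x(2) F by (simp add: E_scaleR)
    finally show ?thesis by (simp add: mult_le_0_iff)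
  qed
  then have "E (\<Union>n. F n) x = 0" using F by (intro E_null_UN) auto
  moreover have "(\<Union>n. F n) = - {t}"
  proof -
    have "\<exists>n. s \<in> F n" if "s \<noteq> t" for s
      using reals_Archimedean[of "\<bar>s - t\<bar>"] that by (auto simp: F_def intro: less_imp_le)
    then show ?thesis by (auto simp: F_def)
  qed
  ultimately show "x \<in> {x. E {t} x = x}" using E_Compl[of "{t}" x] by simp
qed

text \<open>Lindelof replaces the cover by null intervals with a countable one, as countable
  additivity demands.\<close>

lemma null_open:
  assumes U: "open U" and loc: "\<And>s. s \<in> U \<Longrightarrow> \<exists>d>0. \<forall>x. E {s - d<..<s + d} x = 0"
  shows "E U x = 0"
proof -
  obtain d where d: "\<And>s. s \<in> U \<Longrightarrow> d s > 0" "\<And>s x. s \<in> U \<Longrightarrow> E {s - d s<..<s + d s} x = 0"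
    using loc by metis
  let ?F = "(\<lambda>s. {s - d s<..<s + d s}) ` U"
  have "open S" if "S \<in> ?F" for S using that by auto
  then obtain F' where F': "F' \<subseteq> ?F" "countable F'" "\<Union>F' = \<Union>?F"
    by (rule Lindelof)
  have "E (\<Union>S\<in>F'. S) x = 0"
    by (rule E_null_UN[OF F'(2)]) (use F'(1) d in auto)
  moreover have "U \<subseteq> \<Union>F'" unfolding F'(3) using d(1) by fastforce
  moreover have "\<Union>F' \<in> sets borel" unfolding F'(3) by (intro borel_open open_Union) auto
  ultimately show ?thesis using U by (intro E_null_mono[of U "\<Union>F'"]) auto
qed

lemma not_ess_D:
  assumes "complex_of_real t \<notin> ess_spectrum sc A DA"
  obtains e where "e > 0" "\<And>x. E ({t - e<..<t + e} - {t}) x = 0"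
proof (cases "complex_of_real t \<in> resolvent_set sc A DA")
  case True
  then obtain e where e: "e > 0" "\<And>x. E {t - e<..<t + e} x = 0" using resolvent_set_real_iff by blast
  then show ?thesis using E_null_mono[of "{t - e<..<t + e} - {t}" "{t - e<..<t + e}"]
    by (intro that[of e]) auto
next
  case False
  then have "complex_of_real t \<in> disc_spectrum sc A DA"
    using assms by (simp add: ess_spectrum_def op_spectrum_def)
  then obtain e where e: "e > 0" "ball (complex_of_real t) e \<inter> op_spectrum sc A DA = {complex_of_real t}"
    by (auto simp: disc_spectrum_def)
  have "E ({t - e<..<t + e} - {t}) x = 0" for x
  proof (rule null_open)
    fix s assume s: "s \<in> {t - e<..<t + e} - {t}"
    then have "complex_of_real s \<in> ball (complex_of_real t) e"
      by (auto simp: dist_norm simp flip: of_real_diff)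
    moreover have "complex_of_real s \<noteq> complex_of_real t" using s by simp
    ultimately have "complex_of_real s \<in> resolvent_set sc A DA"
      using e(2) unfolding op_spectrum_def by blast
    then show "\<exists>d>0. \<forall>x. E {s - d<..<s + d} x = 0" by (simp add: resolvent_set_real_iff)
  qed auto
  with e(1) show ?thesis by (rule that)
qed

lemma not_ess_finite:
  assumes "complex_of_real t \<notin> ess_spectrum sc A DA"
  shows "finite_cdim sc {x. E {t} x = x}"
proof (cases "complex_of_real t \<in> resolvent_set sc A DA")
  case True
  then obtain e where e: "e > 0" "\<And>x. E {t - e<..<t + e} x = 0" using resolvent_set_real_iff by blast
  then have "E {t} x = 0" for x using E_null_mono[of "{t}" "{t - e<..<t + e}" x] by auto
  then show ?thesis by (auto simp: finite_cdim_def intro!: exI[of _ "{}"])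
next
  case False
  then show ?thesis
    using assms by (auto simp: ess_spectrum_def op_spectrum_def disc_spectrum_def eigenspace_eq)
qed

text \<open>Converse to \<open>not_ess_D\<close> and \<open>not_ess_finite\<close>. The conclusion
  covers every real \<open>s\<close> near \<open>t\<close>, so the real essential spectrum is
  closed; this is why its infimum above \<gamma> is attained.\<close>

lemma not_ess_I:
  assumes e: "\<And>x. E ({t - e<..<t + e} - {t}) x = 0" and fin: "finite_cdim sc {x. E {t} x = x}"
    and s: "\<bar>s - t\<bar> < e"
  shows "complex_of_real s \<notin> ess_spectrum sc A DA"
proof -
  have punct: "complex_of_real s \<in> resolvent_set sc A DA" if "\<bar>s - t\<bar> < e" "s \<noteq> t" for s
  proof -
    define d where "d = min \<bar>s - t\<bar> (e - \<bar>s - t\<bar>)"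
    have "d > 0" "{s - d<..<s + d} \<subseteq> {t - e<..<t + e} - {t}"
      using that by (auto simp: d_def)
    then show ?thesis
      unfolding resolvent_set_real_iff using e E_null_mono[of "{s - d<..<s + d}" "{t - e<..<t + e} - {t}"]
      by (intro exI[of _ d]) auto
  qed
  show ?thesis
  proof (cases "complex_of_real s \<in> resolvent_set sc A DA")
    case True
    then show ?thesis by (simp add: ess_spectrum_def op_spectrum_def)
  next
    case False
    with punct s have [simp]: "s = t" by blast
    have "ball (complex_of_real t) e \<inter> op_spectrum sc A DA = {complex_of_real t}"
    proof (intro subset_antisym subsetI)
      fix z assume z: "z \<in> ball (complex_of_real t) e \<inter> op_spectrum sc A DA"
      then have "Im z = 0" using resolvent_set_nonreal[of z] by (auto simp: op_spectrum_def)
      then have zr: "z = complex_of_real (Re z)" by (simp add: complex_eq_iff)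
      then have "\<bar>Re z - t\<bar> < e" using z abs_Re_le_cmod[of "z - t"] by (auto simp: dist_norm norm_minus_commute)
      then have "Re z = t" using punct[of "Re z"] z zr by (auto simp: op_spectrum_def)
      then show "z \<in> {complex_of_real t}" using zr by simp
    qed (use False s in \<open>auto simp: op_spectrum_def\<close>)
    moreover have "eigenspace sc A DA (complex_of_real t) \<noteq> {0}"
    proof
      assume "eigenspace sc A DA (complex_of_real t) = {0}"
      then have "E {t} x = 0" for x
        using E_idem[of "{t}" x] unfolding eigenspace_eq by auto
      then have "E {t - e<..<t + e} x = 0" for x
      proof -
        have "{t - e<..<t + e} = ({t - e<..<t + e} - {t}) \<union> {t}" using s by auto
        then show ?thesis using E_Un[of "{t - e<..<t + e} - {t}" "{t}" x] e \<open>\<And>x. E {t} x = 0\<close> by auto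
      qed
      then have "complex_of_real t \<in> resolvent_set sc A DA" unfolding resolvent_set_real_iff using s by auto
      with False show False by simp
    qed
    moreover have "e > 0" using s by simp
    ultimately show ?thesis using fin False
      by (auto simp: ess_spectrum_def disc_spectrum_def eigenspace_eq op_spectrum_def)
  qed
qed

end

section \<open>Ranks of spectral projections\<close>

context spectral_resolution
begin

text \<open>\<open>E T\<close> annihilates the span of \<open>B\<close> and fixes the span of
  \<open>C\<close>, so a relation between the two sets reduces to one within
  \<open>C\<close>.\<close>

lemma independent_Un_disjoint:
  assumes S: "S \<in> sets borel" "T \<in> sets borel" "S \<inter> T = {}"
    and B: "\<not> cv.dependent B" "\<And>b. b \<in> B \<Longrightarrow> E S b = b"
    and C: "finite C" "\<not> cv.dependent C" "\<And>c. c \<in> C \<Longrightarrow> E T c = c"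
  shows "\<not> cv.dependent (B \<union> C)" "B \<inter> C = {}"
proof -
  show "\<not> cv.dependent (B \<union> C)"
    using C
  proof (induction C rule: finite_induct)
    case empty
    then show ?case using B by simp
  next
    case (insert c C)
    have c: "\<not> cv.dependent C" "c \<notin> cv.span C"
      using insert.prems insert.hyps cv.independent_insert by auto
    have "c \<notin> cv.span (B \<union> C)"
    proof
      assume "c \<in> cv.span (B \<union> C)"
      then obtain a b where ab: "a \<in> cv.span B" "b \<in> cv.span C" "c = a + b"
        unfolding cv.span_Un by blast
      have "E T a = 0" using E_fix_disjoint[OF S] span_fix[OF S(1) B(2) ab(1)] by blast
      moreover have "E T b = b" using span_fix[OF S(2) _ ab(2)] insert.prems by blast
      moreover have "E T c = c" using insert.prems by blast
      ultimately have "c = b" using ab(3) S by (simp add: E_add)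
      with ab c show False by simp
    qed
    moreover have "\<not> cv.dependent (B \<union> C)" using insert c by blast
    ultimately show ?case using cv.independent_insertI by simp
  qed
  show "B \<inter> C = {}"
  proof (rule ccontr)
    assume "B \<inter> C \<noteq> {}"
    then obtain b where b: "b \<in> B" "b \<in> C" by blast
    then have "b = 0" using E_fix_disjoint[OF S, of b] B(2) C(3) by simp
    then show False using b B(1) cv.dependent_zero by blast
  qed
qed

text \<open>Multiplicities become ranks of spectral projections. Independence serves the upper bound
  for the triple variation, and spanning the lower bound.\<close>

lemma eigenspaces_basis:
  assumes "finite T" "\<And>t. t \<in> T \<Longrightarrow> has_cdim sc (eigenspace sc A DA (complex_of_real t)) (k t)"
  shows "\<exists>B. finite B \<and> \<not> cv.dependent B \<and> card B = (\<Sum>t\<in>T. k t) \<and> (\<forall>b\<in>B. E T b = b)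
    \<and> (\<forall>x. E T x \<in> cv.span B)"
  using assms
proof (induction T rule: finite_induct)
  case empty
  then show ?case by (intro exI[of _ "{}"]) (auto simp: cv.independent_empty)
next
  case (insert t T)
  then obtain B where B: "finite B" "\<not> cv.dependent B" "card B = (\<Sum>t\<in>T. k t)"
    "\<And>b. b \<in> B \<Longrightarrow> E T b = b" "\<And>x. E T x \<in> cv.span B" by auto
  obtain C where C: "finite C" "card C = k t" "\<not> cv.dependent C" "cv.span C = {x. E {t} x = x}"
    using insert.prems[of t] unfolding has_cdim_def eigenspace_eq by blast
  have Cfix: "E {t} c = c" if "c \<in> C" for c using C(4) cv.span_base[OF that] by blast
  have T: "T \<in> sets borel" "{t} \<in> sets borel" "T \<inter> {t} = {}" "insert t T \<in> sets borel"
    using insert.hyps by (auto intro: borel_closed finite_imp_closed)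
  note ind = independent_Un_disjoint[OF T(1-3) B(2,4) C(1,3) Cfix]
  have "card (B \<union> C) = (\<Sum>t\<in>insert t T. k t)"
    using card_Un_disjoint[OF B(1) C(1) ind(2)] B(3) C(2) insert.hyps by simp
  moreover have "E (insert t T) b = b" if "b \<in> B \<union> C" for b
    using that E_fix_mono[OF T(1,4), of b] E_fix_mono[OF T(2,4), of b] B(4) Cfix by auto
  moreover have "E (insert t T) x \<in> cv.span (B \<union> C)" for x
  proof -
    have "E (insert t T) x = E T x + E {t} x" using E_Un[OF T(1-3), of x] by simp
    moreover have "E T x \<in> cv.span (B \<union> C)" using B(5) cv.span_mono[of B "B \<union> C"] by blast
    moreover have "E {t} x \<in> cv.span (B \<union> C)"
      using C(4) E_idem[OF T(2), of x] cv.span_mono[of C "B \<union> C"] by blast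
    ultimately show ?thesis by (simp add: cv.span_add)
  qed
  ultimately show ?case using ind(1) B(1) C(1) by (intro exI[of _ "B \<union> C"]) auto
qed

text \<open>If \<open>E\<close> charges every punctured neighbourhood of \<open>s\<close>, one picks
  a nonzero vector in each of successively smaller disjoint annuli. The inner radius
  \<open>d\<close> is carried along to leave room for the next annulus.\<close>

lemma annuli_independent:
  assumes nonnull: "\<And>d. d > 0 \<Longrightarrow> \<exists>x. E ({s - d<..<s + d} - {s}) x \<noteq> 0" and e: "e > 0"
  shows "\<exists>d B. 0 < d \<and> d \<le> e \<and> finite B \<and> card B = n \<and> \<not> cv.dependent B
    \<and> (\<forall>b\<in>B. E {t. d \<le> \<bar>t - s\<bar> \<and> \<bar>t - s\<bar> < e} b = b)"
proof (induction n)
  case 0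
  show ?case using e by (intro exI[of _ e] exI[of _ "{}"]) (auto simp: cv.independent_empty)
next
  case (Suc n)
  let ?R = "\<lambda>d e. {t. d \<le> \<bar>t - s\<bar> \<and> \<bar>t - s\<bar> < e}"
  have R: "?R d e \<in> sets borel" for d e by measurable
  from Suc obtain d B where B: "0 < d" "d \<le> e" "finite B" "card B = n" "\<not> cv.dependent B"
    "\<And>b. b \<in> B \<Longrightarrow> E (?R d e) b = b" by blast
  obtain x where x: "E ({s - d<..<s + d} - {s}) x \<noteq> 0" using nonnull[OF B(1)] by blast
  have "{s - d<..<s + d} - {s} = (\<Union>k. ?R (inverse (real (Suc k))) d)"
  proof -
    have "\<exists>k. inverse (real (Suc k)) \<le> \<bar>t - s\<bar>" if "t \<noteq> s" for t
      using reals_Archimedean[of "\<bar>t - s\<bar>"] that by (auto intro: less_imp_le)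
    then show ?thesis by fastforce
  qed
  with x obtain k where k: "E (?R (inverse (real (Suc k))) d) x \<noteq> 0"
    using E_null_UN[of UNIV "\<lambda>k. ?R (inverse (real (Suc k))) d" x] R by auto
  define y where "y = E (?R (inverse (real (Suc k))) d) x"
  define d' where "d' = min d (inverse (real (Suc k)))"
  have "E (?R d' d) y = y"
    by (rule E_fix_mono[OF R[of "inverse (real (Suc k))" d] R]) (auto simp: d'_def y_def E_idem[OF R])
  then have y: "E (?R d' d) b = b" if "b \<in> {y}" for b using that by simp
  have "y \<noteq> 0" using k by (simp add: y_def)
  then have indy: "\<not> cv.dependent {y}" by simp
  have disj: "?R d e \<inter> ?R d' d = {}" by auto
  have ind: "\<not> cv.dependent (B \<union> {y})" "B \<inter> {y} = {}"
    by (rule independent_Un_disjoint[OF R R disj B(5,6) _ indy y]; simp)+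
  have "E (?R d' e) b = b" if "b \<in> B \<union> {y}" for b
  proof (cases "b \<in> B")
    case True
    then show ?thesis by (intro E_fix_mono[OF R[of d e] R _ B(6)]) (auto simp: d'_def)
  next
    case False
    then have "b \<in> {y}" using that by blast
    moreover have "?R d' d \<subseteq> ?R d' e" using B(2) by auto
    ultimately show ?thesis using E_fix_mono[OF R R _ y] by blast
  qed
  moreover have "card (B \<union> {y}) = Suc n" using ind(2) B(3,4) by simp
  moreover have "0 < d'" "d' \<le> e" using B(1,2) by (auto simp: d'_def)
  ultimately show ?case using B(3) ind(1) by (intro exI[of _ d'] exI[of _ "B \<union> {y}"]) auto
qed

text \<open>Either some punctured neighbourhood of \<open>s\<close> is null, and then
  \<open>E {s}\<close> has infinite rank, or the spectrum accumulates at \<open>s\<close> and annuli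
  supply the vectors.\<close>

lemma ess_spectrum_infinite_dim:
  assumes ess: "complex_of_real s \<in> ess_spectrum sc A DA" and s: "a < s" "s < b"
  shows "\<exists>B. finite B \<and> card B = n \<and> \<not> cv.dependent B \<and> (\<forall>b'\<in>B. E {a<..<b} b' = b')"
proof (cases "\<exists>d>0. \<forall>x. E ({s - d<..<s + d} - {s}) x = 0")
  case True
  then obtain d where d: "d > 0" "\<And>x. E ({s - d<..<s + d} - {s}) x = 0" by blast
  have nfin: "\<not> finite_cdim sc {x. E {s} x = x}"
    using not_ess_I[OF d(2), of s] ess d(1) by auto
  obtain B where B: "B \<subseteq> {x. E {s} x = x}" "\<not> cv.dependent B" "{x. E {s} x = x} \<subseteq> cv.span B"
    using cv.maximal_independent_subset[of "{x. E {s} x = x}"] by blast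
  have "infinite B" using nfin B(3) by (auto simp: finite_cdim_def)
  then obtain B' where B': "finite B'" "card B' = n" "B' \<subseteq> B" using infinite_arbitrarily_large by blast
  have "E {a<..<b} x = x" if "x \<in> B'" for x
    using that B' B s by (intro E_fix_mono[of "{s}" "{a<..<b}"]) auto
  then show ?thesis using B' B(2) cv.dependent_mono by blast
next
  case False
  define e where "e = min (s - a) (b - s)"
  have e: "e > 0" using s by (simp add: e_def)
  obtain d B where B: "0 < d" "finite B" "card B = n" "\<not> cv.dependent B"
    "\<And>x. x \<in> B \<Longrightarrow> E {t. d \<le> \<bar>t - s\<bar> \<and> \<bar>t - s\<bar> < e} x = x"
    using annuli_independent[OF _ e, of s n] False by blast
  have "E {a<..<b} x = x" if "x \<in> B" for x
    by (rule E_fix_mono[OF _ _ _ B(5)[OF that]]) (auto simp: e_def)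
  then show ?thesis using B by blast
qed

lemma E_discrete_part:
  assumes T: "finite T" "T \<subseteq> {a<..<b}"
    and disc: "\<And>s. s \<in> {a<..<b} - T \<Longrightarrow> complex_of_real s \<notin> ess_spectrum sc A DA
        \<and> eigenspace sc A DA (complex_of_real s) = {0}"
  shows "E {a<..<b} x = E T x"
proof -
  have Tb: "T \<in> sets borel" "closed T" using T by (auto intro: borel_closed finite_imp_closed)
  have "E ({a<..<b} - T) x = 0"
  proof (rule null_open)
    show "open ({a<..<b} - T)" using Tb by (intro open_Diff) auto
    fix s assume s: "s \<in> {a<..<b} - T"
    obtain e where e: "e > 0" "\<And>x. E ({s - e<..<s + e} - {s}) x = 0"
      using not_ess_D disc[OF s] by blast
    have "E {s} x = 0" for x using disc[OF s] E_idem[of "{s}" x] unfolding eigenspace_eq by auto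
    then have "E {s - e<..<s + e} x = 0" for x
    proof -
      have "{s - e<..<s + e} = ({s - e<..<s + e} - {s}) \<union> {s}" using e by auto
      then show ?thesis using E_Un[of "{s - e<..<s + e} - {s}" "{s}" x] e \<open>\<And>x. E {s} x = 0\<close> by auto
    qed
    with e(1) show "\<exists>d>0. \<forall>x. E {s - d<..<s + d} x = 0" by blast
  qed
  moreover have "{a<..<b} = ({a<..<b} - T) \<union> T" using T by auto
  ultimately show ?thesis using E_Un[of "{a<..<b} - T" T x] Tb by auto
qed

end

section \<open>Bounds for the triple variation from ranks\<close>

context spectral_gap
begin

lemma D_bounded:
  assumes "S \<in> sets borel" "E S x = x" "\<And>t. t \<in> S \<Longrightarrow> \<bar>t\<bar> \<le> k"
  shows "x \<in> D"
  using DA_integrable[OF DA_bounded[OF assms]] by (simp add: form_dom_def)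

definition Dplus :: "'h set" where "Dplus = {x \<in> D. E {\<gamma><..} x = x}"

lemma csubspace_Dplus: "cv.subspace Dplus"
proof -
  have "Dplus = D \<inter> {x. E {\<gamma><..} x = x}" by (auto simp: Dplus_def)
  then show ?thesis using cv.subspace_inter[OF csubspace_D csubspace_fix[of "{\<gamma><..}"]] by simp
qed

lemma Dplus_I: "E {\<gamma><..<t} x = x \<Longrightarrow> x \<in> Dplus"
  unfolding Dplus_def using D_bounded[of "{\<gamma><..<t}" x "\<bar>\<gamma>\<bar> + \<bar>t\<bar>"] E_fix_mono[of "{\<gamma><..<t}" "{\<gamma><..}" x]
  by fastforce

text \<open>A larger non-negative subspace would contain \<open>E {..\<gamma>} x\<close> for each of
  its vectors \<open>x\<close>. There \<open>qp\<close> vanishes, hence so does \<open>qm\<close>,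
  and the gap makes this component zero.\<close>

lemma Dplus_Mplus: "Dplus \<in> Mplus sc ip E \<gamma>"
  unfolding Mplus_def
proof (intro CollectI conjI allI impI)
  show "nonneg_subspace sc ip E \<gamma> Dplus"
    unfolding nonneg_subspace_iff using csubspace_Dplus qm_E_gt qp.nonneg by (auto simp: Dplus_def)
  fix M assume M: "nonneg_subspace sc ip E \<gamma> M \<and> Dplus \<subseteq> M"
  then have sub: "cv.subspace M" "M \<subseteq> D" and le: "\<And>x. x \<in> M \<Longrightarrow> qm x \<le> qp x"
    by (auto simp: nonneg_subspace_iff)
  have "x \<in> Dplus" if x: "x \<in> M" for x
  proof -
    have xD: "x \<in> D" using x sub by auto
    have "E {\<gamma><..} x \<in> Dplus" using xD by (simp add: Dplus_def E_D E_idem)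
    then have "x - E {\<gamma><..} x \<in> M" using M x sub by (intro cv.subspace_diff) auto
    then have yM: "E {..\<gamma>} x \<in> M" using E_Compl[of "{\<gamma><..}" x] by simp
    then have yD: "E {..\<gamma>} x \<in> D" using sub by auto
    have qp0: "qp (E {..\<gamma>} x) = 0" using yD by (intro qp_E_le) (auto simp: E_idem)
    moreover have "qm (E {..\<gamma>} x) \<le> 0" using le[OF yM] qp0 by simp
    ultimately have "\<delta> * (norm (E {..\<gamma>} x))\<^sup>2 \<le> 0" using norm_le_qp_qm[OF yD] by linarith
    then have "E {..\<gamma>} x = 0" using \<delta> by (simp add: mult_le_0_iff)
    then show ?thesis using E_decomp[of x] xD by (simp add: Dplus_def)
  qed
  with M show "M = Dplus" by blast
qed

text \<open>\<open>C\<close> only guarantees enough room in \<open>Dplus\<close>: the span of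
  \<open>B\<close> may be too small and must be padded to dimension exactly
  \<open>n - 1\<close>.\<close>

lemma triple_var_ge:
  assumes B: "finite B" "\<not> cv.dependent B" "card B \<le> n - 1" "\<And>b. b \<in> B \<Longrightarrow> E {\<gamma><..<t} b = b"
      "\<And>x. E {\<gamma><..<t} x \<in> cv.span B"
    and C: "finite C" "\<not> cv.dependent C" "n - 1 \<le> card C" "C \<subseteq> Dplus" and t: "\<gamma> < t"
  shows "ereal t \<le> triple_var sc ip E \<gamma> n"
proof -
  obtain F where F: "B \<subseteq> F" "F \<subseteq> B \<union> C" "\<not> cv.dependent F" "B \<union> C \<subseteq> cv.span F"
    using cv.maximal_independent_subset_extend[of B "B \<union> C"] B(2) by blast
  have finF: "finite F" using F(2) B(1) C(1) finite_subset by blast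
  have "card C \<le> card F" using cv.independent_span_bound[OF finF C(2)] F(4) by blast
  then obtain G where G: "B \<subseteq> G" "G \<subseteq> F" "card G = n - 1"
    using exists_subset_between[OF B(3) _ F(1) finF] C(3) by auto
  define L where "L = cv.span G"
  have "L \<subseteq> Dplus"
    unfolding L_def using G F(2) C(4) B(4) Dplus_I by (intro cv.span_minimal csubspace_Dplus) blast
  moreover have "has_cdim sc L (n - 1)"
    unfolding has_cdim_def L_def using G finF F(3) finite_subset[of G F] cv.dependent_mono[of G F]
    by (intro exI[of _ G]) auto
  ultimately have L: "L \<in> {L. L \<subseteq> Dplus \<and> has_cdim sc L (n - 1)}" by simp
  \<comment> \<open>If no admissible \<open>x\<close> exists, the infimum is infinite and the bound
    is trivial.\<close>
  have "ereal t \<le> (INF x\<in>{x\<in>Dplus. x \<noteq> 0 \<and> (\<forall>y\<in>L. ip x y = 0)}. ereal (form_q ip E x / (norm x)\<^sup>2))"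
  proof (rule INF_greatest)
    fix x assume "x \<in> {x\<in>Dplus. x \<noteq> 0 \<and> (\<forall>y\<in>L. ip x y = 0)}"
    then have x: "x \<in> D" "E {\<gamma><..} x = x" "x \<noteq> 0" "\<And>y. y \<in> L \<Longrightarrow> ip x y = 0"
      by (auto simp: Dplus_def)
    have "E {\<gamma><..<t} x \<in> L" unfolding L_def using B(5) cv.span_mono[OF G(1)] by blast
    then have "ip x (E {\<gamma><..<t} x) = 0" by (rule x(4))
    then have "E {\<gamma><..<t} x = 0"
      using Re_ip_E[of "{\<gamma><..<t}" x] E_sym[of "{\<gamma><..<t}" x x] by simp
    moreover have "E {\<gamma><..} x = E {\<gamma><..<t} x + E {t..} x"
    proof -
      have "E ({\<gamma><..<t} \<union> {t..}) x = E {\<gamma><..<t} x + E {t..} x" by (rule E_Un) auto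
      moreover have "{\<gamma><..<t} \<union> {t..} = {\<gamma><..}" using t by auto
      ultimately show ?thesis by (simp only:)
    qed
    ultimately have "E {t..} x = x" using x(2) by simp
    then have "t * (norm x)\<^sup>2 \<le> form_q ip E x"
      unfolding form_q_def using x(1) by (intro integral_ge[of x "{t..}"]) (auto simp: form_dom_def)
    then show "ereal t \<le> ereal (form_q ip E x / (norm x)\<^sup>2)" using x(3) by (simp add: pos_le_divide_eq)
  qed
  then show ?thesis
    unfolding triple_var_def by (intro SUP_upper2[OF Dplus_Mplus] SUP_upper2[OF L])
qed

lemma triple_var_le:
  assumes B: "finite B" "\<not> cv.dependent B" "card B = n" "\<And>b. b \<in> B \<Longrightarrow> E {\<gamma><..<t} b = b"
    and n: "1 \<le> n" and t: "\<gamma> < t"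
  shows "triple_var sc ip E \<gamma> n \<le> ereal t"
  unfolding triple_var_def
proof (intro SUP_least)
  fix M L assume M: "M \<in> Mplus sc ip E \<gamma>" and "L \<in> {L. L \<subseteq> M \<and> has_cdim sc L (n - 1)}"
  then obtain C where C: "finite C" "card C = n - 1" "cv.span C = L" by (auto simp: has_cdim_def)
  let ?P = "E {\<gamma><..}"
  have sub: "cv.subspace M" "M \<subseteq> D" using M by (auto simp: Mplus_def nonneg_subspace_iff)
  have "\<exists>m\<in>M. ?P m = b" if "b \<in> B" for b
    using Mplus_projection_surj[OF M, of b] Dplus_I[OF B(4)[OF that]] by (auto simp: Dplus_def)
  then obtain m where m: "\<And>b. b \<in> B \<Longrightarrow> m b \<in> M" "\<And>b. b \<in> B \<Longrightarrow> ?P (m b) = b" by metis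
  \<comment> \<open>The lifts are chosen vector by vector, so their independence is not assumed.
    \<open>?P\<close> maps the span of \<open>F\<close> onto a space containing \<open>B\<close>,
    which forces \<open>F\<close> to have at least \<open>n\<close> elements.\<close>
  obtain F where F: "F \<subseteq> m ` B" "\<not> cv.dependent F" "m ` B \<subseteq> cv.span F"
    using cv.maximal_independent_subset[of "m ` B"] by blast
  have finF: "finite F" using F(1) B(1) finite_subset by blast
  have Pspan: "?P x \<in> cv.span (?P ` F)" if "x \<in> cv.span F" for x
    using that
  proof (induction rule: cv.span_induct_alt)
    case (step c a y)
    then show ?case by (simp add: E_add E_sc cv.span_add cv.span_scale cv.span_base)
  qed (simp add: cv.span_zero)
  have "B \<subseteq> cv.span (?P ` F)" using Pspan F(3) m(2) by (metis image_subset_iff subsetI)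
  then have "card B \<le> card (?P ` F)" using cv.independent_span_bound[of "?P ` F" B] B(2) finF by blast
  then have "card C < card F" using card_image_le[OF finF, of ?P] B(3) C(2) n by linarith
  from underdetermined_orthogonal[OF C(1) finF F(2) this]
  obtain x where x: "x \<in> cv.span F" "x \<noteq> 0" "\<forall>y\<in>C. ip x y = 0" by blast
  have xM: "x \<in> M" using x(1) F(1) m(1) sub(1) cv.span_minimal[of F M] by blast
  then have xD: "x \<in> D" using sub by auto
  have perp: "ip x y = 0" if "y \<in> L" for y
    using that unfolding C(3)[symmetric]
    by (induction rule: cv.span_induct_alt) (use x(3) in \<open>auto simp: ip_simps\<close>)
  \<comment> \<open>The positive part of \<open>x\<close> lives in (\<gamma>, t) and the rest at or
    below \<gamma>; the latter needs no control, as only an upper bound on the quotient is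
    wanted.\<close>
  have "E {\<gamma><..<t} (?P x) = ?P x"
  proof (rule span_fix[OF _ _ Pspan[OF x(1)]])
    fix b assume "b \<in> ?P ` F"
    then obtain b' where "b' \<in> B" "b = ?P (m b')" using F(1) by blast
    then show "E {\<gamma><..<t} b = b" using m(2) B(4) by simp
  qed simp
  then have "E {..<t} (?P x) = ?P x" by (intro E_fix_mono[of "{\<gamma><..<t}" "{..<t}"]) auto
  moreover have "E {..<t} (E {..\<gamma>} x) = E {..\<gamma>} x" using t by (intro E_subset) auto
  ultimately have "E {..<t} (?P x + E {..\<gamma>} x) = ?P x + E {..\<gamma>} x" by (simp add: E_add)
  then have "E {..<t} x = x" unfolding E_decomp .
  then have "form_q ip E x \<le> t * (norm x)\<^sup>2"
    unfolding form_q_def using xD by (intro integral_le[of x "{..<t}"]) (auto simp: form_dom_def)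
  then have "ereal (form_q ip E x / (norm x)\<^sup>2) \<le> ereal t" using x(2) by (simp add: pos_divide_le_eq)
  moreover have "x \<in> {x\<in>M. x \<noteq> 0 \<and> (\<forall>y\<in>L. ip x y = 0)}" using xM x(2) perp by simp
  ultimately show "(INF x\<in>{x\<in>M. x \<noteq> 0 \<and> (\<forall>y\<in>L. ip x y = 0)}. ereal (form_q ip E x / (norm x)\<^sup>2)) \<le> ereal t"
    by (intro INF_lower2)
qed

end

section \<open>The variational principle\<close>

theorem theorem3p1:
  fixes sc :: "complex \<Rightarrow> 'h::banach \<Rightarrow> 'h"
    and ip :: "'h \<Rightarrow> 'h \<Rightarrow> complex"
    and A :: "'h \<Rightarrow> 'h" and DA :: "'h set"
    and E :: "real set \<Rightarrow> 'h \<Rightarrow> 'h"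
    and \<gamma> :: real and lam :: "nat \<Rightarrow> real" and N :: enat and lam_e :: ereal
  assumes hilb: "complex_hilbert sc ip"
    and sa: "selfadjoint sc ip A DA"
    and E: "spectral_measure_of sc ip A DA E"
    and res: "complex_of_real \<gamma> \<in> resolvent_set sc A DA"
    and lam_e: "lam_e = Inf (ereal ` {t. \<gamma> < t \<and> complex_of_real t \<in> ess_spectrum sc A DA})"
    and lam_range: "\<forall>j. 1 \<le> j \<and> enat j \<le> N \<longrightarrow> \<gamma> < lam j \<and> ereal (lam j) < lam_e"
    and lam_mono: "\<forall>i j. 1 \<le> i \<and> i \<le> j \<and> enat j \<le> N \<longrightarrow> lam i \<le> lam j"
    and lam_mult: "\<forall>t. \<gamma> < t \<and> ereal t < lam_e \<longrightarrow>
          finite {j. 1 \<le> j \<and> enat j \<le> N \<and> lam j = t}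
        \<and> has_cdim sc (eigenspace sc A DA (complex_of_real t))
                     (card {j. 1 \<le> j \<and> enat j \<le> N \<and> lam j = t})"
  shows "(\<forall>n. 1 \<le> n \<and> enat n \<le> N \<longrightarrow> triple_var sc ip E \<gamma> n = ereal (lam n))
       \<and> (N \<noteq> \<infinity> \<and> {t. \<gamma> < t \<and> complex_of_real t \<in> ess_spectrum sc A DA} \<noteq> {} \<longrightarrow>
           (\<forall>n. enat n > N \<longrightarrow>
              (\<exists>m\<in>{t. \<gamma> < t \<and> complex_of_real t \<in> ess_spectrum sc A DA}.
                  (\<forall>s\<in>{t. \<gamma> < t \<and> complex_of_real t \<in> ess_spectrum sc A DA}. m \<le> s)
                \<and> triple_var sc ip E \<gamma> n = ereal m)))"
proof -
  interpret spectral_resolution sc ip A DA E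
    by unfold_locales (use hilb sa E in auto)
  obtain \<delta> where \<delta>: "\<delta> > 0" "\<And>x. E {\<gamma> - \<delta><..<\<gamma> + \<delta>} x = 0"
    using res resolvent_set_real_iff by blast
  interpret spectral_gap sc ip A DA E \<gamma> \<delta>
    by unfold_locales (use \<delta> in auto)
  define G where "G = {t. \<gamma> < t \<and> complex_of_real t \<in> ess_spectrum sc A DA}"
  define idx where "idx t = {j. 1 \<le> j \<and> enat j \<le> N \<and> lam j = t}" for t
  have idx: "finite (idx t)" "has_cdim sc (eigenspace sc A DA (complex_of_real t)) (card (idx t))"
    if "\<gamma> < t" "ereal t < lam_e" for t
    using lam_mult that by (auto simp: idx_def)
  have notess: "complex_of_real t \<notin> ess_spectrum sc A DA" if "\<gamma> < t" "ereal t < lam_e" for t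
  proof
    assume "complex_of_real t \<in> ess_spectrum sc A DA"
    then have "lam_e \<le> ereal t" unfolding lam_e using that by (intro Inf_lower) auto
    with that show False by simp
  qed
  \<comment> \<open>Up to \<open>lam_e\<close> the spectrum is discrete, so the listed eigenvalues
    below \<open>b\<close> account for the whole range of the projection.\<close>
  have low: "\<exists>B. finite B \<and> \<not> cv.dependent B \<and> card B = card {j. 1 \<le> j \<and> enat j \<le> N \<and> lam j < b}
      \<and> (\<forall>x\<in>B. E {\<gamma><..<b} x = x) \<and> (\<forall>x. E {\<gamma><..<b} x \<in> cv.span B)"
    if b: "ereal b \<le> lam_e" and fin: "finite {j. 1 \<le> j \<and> enat j \<le> N \<and> lam j < b}" for b
  proof -
    define J where "J = {j. 1 \<le> j \<and> enat j \<le> N \<and> lam j < b}"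
    define T where "T = lam ` J"
    have finT: "finite T" using fin by (simp add: T_def J_def)
    have Tsub: "T \<subseteq> {\<gamma><..<b}" using lam_range by (auto simp: T_def J_def)
    have below: "\<gamma> < s" "ereal s < lam_e" if "s \<in> {\<gamma><..<b}" for s
      using that b by (auto intro: less_le_trans[of "ereal s" "ereal b"])
    have ETx: "E {\<gamma><..<b} x = E T x" for x
    proof (rule E_discrete_part[OF finT Tsub])
      fix s assume s: "s \<in> {\<gamma><..<b} - T"
      then have "idx s = {}" by (auto simp: idx_def T_def J_def)
      then have "has_cdim sc (eigenspace sc A DA (complex_of_real s)) 0"
        using idx(2)[OF below] s by fastforce
      then obtain B where B: "finite B" "card B = 0" "cv.span B = eigenspace sc A DA (complex_of_real s)"
        unfolding has_cdim_def by blast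
      then have "B = {}" by simp
      with B(3) have "eigenspace sc A DA (complex_of_real s) = {0}" by simp
      with notess[OF below] s show "complex_of_real s \<notin> ess_spectrum sc A DA
          \<and> eigenspace sc A DA (complex_of_real s) = {0}" by blast
    qed
    have "\<And>t. t \<in> T \<Longrightarrow> has_cdim sc (eigenspace sc A DA (complex_of_real t)) (card (idx t))"
      using idx(2) below Tsub by blast
    from eigenspaces_basis[OF finT this]
    obtain B where B: "finite B" "\<not> cv.dependent B" "card B = (\<Sum>t\<in>T. card (idx t))"
      "\<forall>x\<in>B. E T x = x" "\<forall>x. E T x \<in> cv.span B" by blast
    have "(\<Sum>t\<in>T. card (idx t)) = card (\<Union>t\<in>T. idx t)"
      using finT idx(1) below Tsub by (intro card_UN_disjoint[symmetric]) (auto simp: idx_def)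
    also have "(\<Union>t\<in>T. idx t) = J" by (auto simp: T_def J_def idx_def)
    finally show ?thesis using B by (intro exI[of _ B]) (simp add: ETx J_def)
  qed
  have part1: "triple_var sc ip E \<gamma> n = ereal (lam n)" if n: "1 \<le> n" "enat n \<le> N" for n
  proof -
    have ln: "\<gamma> < lam n" "ereal (lam n) < lam_e" using lam_range n by auto
    have leN: "enat j \<le> N" if "j \<le> n" for j using that n(2) by (meson enat_ord_simps(1) order_trans)
    \<comment> \<open>Here \<open>t\<close> may exceed \<open>lam_e\<close>, where
      \<open>low\<close> says nothing; the eigenspaces of the first \<open>n\<close> listed values
      suffice. They may have total dimension above \<open>n\<close> when \<open>lam n\<close> is
      repeated later in the list, so a subset is taken.\<close>
    have up: "\<exists>B. finite B \<and> \<not> cv.dependent B \<and> card B = n \<and> (\<forall>b\<in>B. E {\<gamma><..<t} b = b)"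
      if t: "lam n < t" for t
    proof -
      define T where "T = lam ` {1..n}"
      have T: "\<gamma> < s" "ereal s < lam_e" "s < t" if "s \<in> T" for s
      proof -
        obtain j where j: "1 \<le> j" "j \<le> n" "s = lam j" using \<open>s \<in> T\<close> by (auto simp: T_def)
        show "\<gamma> < s" "ereal s < lam_e" using lam_range j leN by blast+
        have "lam j \<le> lam n" using lam_mono j n by blast
        then show "s < t" using j t by simp
      qed
      have finT: "finite T" by (simp add: T_def)
      from eigenspaces_basis[OF this idx(2)] T
      obtain B where B: "finite B" "\<not> cv.dependent B" "card B = (\<Sum>t\<in>T. card (idx t))"
        "\<forall>x\<in>B. E T x = x" by blast
      have "{1..n} \<subseteq> (\<Union>t\<in>T. idx t)" using leN by (auto simp: T_def idx_def)
      then have "n \<le> card (\<Union>t\<in>T. idx t)"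
        using card_mono[of "\<Union>t\<in>T. idx t" "{1..n}"] finT idx(1) T by fastforce
      also have "\<dots> \<le> card B" unfolding B(3) by (rule card_UN_le[OF finT])
      finally obtain B' where B': "B' \<subseteq> B" "card B' = n" using obtain_subset_with_card_n by metis
      have "E {\<gamma><..<t} b = b" if "b \<in> B'" for b
        using that B' B(4) T finT by (intro E_fix_mono[of T "{\<gamma><..<t}"]) (auto intro: borel_closed finite_imp_closed)
      then show ?thesis using B' B(1,2) cv.dependent_mono[of B' B] finite_subset by blast
    qed
    show ?thesis
    proof (rule antisym)
      show "triple_var sc ip E \<gamma> n \<le> ereal (lam n)"
      proof (rule ereal_le_epsilon2)
        fix e :: real assume "0 < e"
        then obtain B where "finite B" "\<not> cv.dependent B" "card B = n" "\<forall>b\<in>B. E {\<gamma><..<lam n + e} b = b"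
          using up[of "lam n + e"] by auto
        then have "triple_var sc ip E \<gamma> n \<le> ereal (lam n + e)"
          using n ln \<open>0 < e\<close> by (intro triple_var_le[of B]) auto
        then show "triple_var sc ip E \<gamma> n \<le> ereal (lam n) + ereal e" by simp
      qed
      \<comment> \<open>The strict inequality matters: by monotonicity only indices smaller than
        \<open>n\<close> occur, so the rank is at most \<open>n - 1\<close>.\<close>
      let ?J = "{j. 1 \<le> j \<and> enat j \<le> N \<and> lam j < lam n}"
      have J: "?J \<subseteq> {1..<n}"
      proof
        fix j assume j: "j \<in> ?J"
        then have "j < n" using lam_mono n by (metis (mono_tags, lifting) linorder_not_le mem_Collect_eq)
        with j show "j \<in> {1..<n}" by simp
      qed
      then have finJ: "finite ?J" using finite_subset by blast
      obtain B where B: "finite B" "\<not> cv.dependent B" "card B = card ?J"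
        "\<And>x. x \<in> B \<Longrightarrow> E {\<gamma><..<lam n} x = x" "\<And>x. E {\<gamma><..<lam n} x \<in> cv.span B"
        using low[OF _ finJ] ln by (auto simp: less_imp_le)
      have cJ: "card ?J \<le> n - 1" using card_mono[OF _ J] by simp
      obtain C where C: "finite C" "\<not> cv.dependent C" "card C = n" "\<forall>b\<in>C. E {\<gamma><..<lam n + 1} b = b"
        using up[of "lam n + 1"] by auto
      show "ereal (lam n) \<le> triple_var sc ip E \<gamma> n"
        using B C cJ ln by (intro triple_var_ge[of B _ _ C]) (auto intro: Dplus_I)
    qed
  qed
  have part2: "\<exists>m\<in>G. (\<forall>s\<in>G. m \<le> s) \<and> triple_var sc ip E \<gamma> n = ereal m"
    if N: "N \<noteq> \<infinity>" and G0: "G \<noteq> {}" and n: "enat n > N" for n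
  proof -
    define m where "m = Inf G"
    have bdd: "bdd_below G" by (rule bdd_belowI[of _ \<gamma>]) (auto simp: G_def)
    have mle: "m \<le> s" if "s \<in> G" for s unfolding m_def using that bdd by (rule cInf_lower)
    have m\<gamma>: "\<gamma> \<le> m" unfolding m_def using G0 by (intro cInf_greatest) (auto simp: G_def)
    \<comment> \<open>Otherwise a whole neighbourhood of \<open>m\<close> would avoid the essential
      spectrum, although points of \<open>G\<close> come arbitrarily close.\<close>
    have mess: "complex_of_real m \<in> ess_spectrum sc A DA"
    proof (rule ccontr)
      assume *: "complex_of_real m \<notin> ess_spectrum sc A DA"
      obtain e where e: "e > 0" "\<And>x. E ({m - e<..<m + e} - {m}) x = 0" using not_ess_D[OF *] by blast
      obtain s where s: "s \<in> G" "s < m + e"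
        using cInf_lessD[OF G0, of "m + e"] e(1) by (auto simp: m_def)
      then have "\<bar>s - m\<bar> < e" using mle[OF s(1)] by simp
      from not_ess_I[OF e(2) not_ess_finite[OF *] this] s(1) show False by (simp add: G_def)
    qed
    have "m \<noteq> \<gamma>" using mess res by (auto simp: ess_spectrum_def op_spectrum_def)
    then have \<gamma>m: "\<gamma> < m" using m\<gamma> by simp
    then have mG: "m \<in> G" using mess by (simp add: G_def)
    have lam_e_m: "lam_e = ereal m"
      unfolding lam_e G_def[symmetric] using mG mle by (intro antisym Inf_lower Inf_greatest) auto
    obtain N' where N': "N = enat N'" using N by (cases N) auto
    then have n1: "1 \<le> n" "N' \<le> n - 1" using n by auto
    \<comment> \<open>Any interval reaching past \<open>m\<close> has infinite rank, which gives the
      same upper bound for every \<open>n\<close>.\<close>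
    have up: "\<exists>B. finite B \<and> card B = n \<and> \<not> cv.dependent B \<and> (\<forall>b\<in>B. E {\<gamma><..<t} b = b)" if "m < t" for t
      by (rule ess_spectrum_infinite_dim[OF mess \<gamma>m that])
    have "triple_var sc ip E \<gamma> n = ereal m"
    proof (rule antisym)
      show "triple_var sc ip E \<gamma> n \<le> ereal m"
      proof (rule ereal_le_epsilon2)
        fix e :: real assume "0 < e"
        then obtain B where "finite B" "\<not> cv.dependent B" "card B = n" "\<forall>b\<in>B. E {\<gamma><..<m + e} b = b"
          using up[of "m + e"] by auto
        then have "triple_var sc ip E \<gamma> n \<le> ereal (m + e)"
          using n1 \<gamma>m \<open>0 < e\<close> by (intro triple_var_le[of B]) auto
        then show "triple_var sc ip E \<gamma> n \<le> ereal m + ereal e" by simp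
      qed
      let ?J = "{j. 1 \<le> j \<and> enat j \<le> N \<and> lam j < m}"
      have J: "?J \<subseteq> {1..N'}" by (auto simp: N')
      then have finJ: "finite ?J" using finite_subset by blast
      obtain B where B: "finite B" "\<not> cv.dependent B" "card B = card ?J"
        "\<And>x. x \<in> B \<Longrightarrow> E {\<gamma><..<m} x = x" "\<And>x. E {\<gamma><..<m} x \<in> cv.span B"
        using low[OF _ finJ] lam_e_m by auto
      have cJ: "card ?J \<le> n - 1" using card_mono[OF _ J] n1 by simp
      obtain C where C: "finite C" "\<not> cv.dependent C" "card C = n" "\<forall>b\<in>C. E {\<gamma><..<m + 1} b = b"
        using up[of "m + 1"] by auto
      show "ereal m \<le> triple_var sc ip E \<gamma> n"
        using B C cJ \<gamma>m by (intro triple_var_ge[of B _ _ C]) (auto intro: Dplus_I)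
    qed
    then show ?thesis using mG mle by blast
  qed
  show ?thesis using part1 part2 unfolding G_def by blast
qed

end
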